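(* Let $G$ be a connected Milnor regular Lie group (possibly infinite-dimensional) whose Lie algebra $\mathfrak{g}$ is topologically perfect, i.e. $\overline{[\mathfrak{g},\mathfrak{g}]} = \mathfrak{g}$. Then there are no non-zero bi-invariant differential 2-forms on $G$.
   Context: "Lie group" means a group object in smooth manifolds modelled on real (Hausdorff) locally convex topological vector spaces, with smoothness in the usual sense for locally convex spaces (iterated directional derivatives exist and are jointly continuous). The Lie algebra $\mathfrak{g}=T_eG$ is a locally convex space with continuous Lie bracket. $G$ is Milnor regular if for every smooth curve $c\colon[0,1]\to\mathfrak{g}$ there is a (necessarily unique) smooth curve $\gamma_c\colon[0,1]\to G$ with $\gamma_c(0)=e$ and left logarithmic derivative $c$, and the map $C^\infty([0,1],\mathfrak{g})\to G$, $c\mapsto\gamma_c(1)$, is smooth. $[\mathfrak{g},\mathfrak{g}]$ is the linear span of all brackets and the bar denotes closure in $\mathfrak{g}$. Differential forms are smooth and real-valued. A differential 2-form $\eta$ on $G$ is bi-invariant if $L_g^*\eta=\eta=R_g^*\eta$ for all $g\in G$, where $L_g,R_g$ are left and right translation by $g$. *)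

theory Defs
  imports "HOL-Analysis.Analysis" "HOL-Library.Function_Algebras"
begin

section \<open>Locally convex spaces\<close>

text \<open>
  Real Hausdorff locally convex topological vector spaces. The first conjunct of
  \<open>locally_convex\<close> is the unfolding of \<^const>\<open>convex\<close>, which cannot be used inside
  the class declaration; see \<open>locally_convex'\<close> for the folded form.
\<close>

class locally_convex_space = real_vector + topological_ab_group_add + t2_space +
  assumes tendsto_scaleR_Pair:
      "LIM x (nhds c \<times>\<^sub>F nhds a). fst x *\<^sub>R snd x :> nhds (c *\<^sub>R a)"
    and locally_convex:
      "eventually (\<lambda>x. x \<in> U) (nhds 0) \<Longrightarrow>
       \<exists>V. (\<forall>x\<in>V. \<forall>y\<in>V. \<forall>u\<ge>0. \<forall>v\<ge>0. u + v = 1 \<longrightarrow> u *\<^sub>R x + v *\<^sub>R y \<in> V)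
           \<and> V \<subseteq> U \<and> eventually (\<lambda>x. x \<in> V) (nhds 0)"

lemmas locally_convex' = locally_convex[folded convex_def]

lemma tendsto_scaleR_lcs:
  fixes g :: "'b \<Rightarrow> 'a::locally_convex_space"
  assumes "(f \<longlongrightarrow> c) F" "(g \<longlongrightarrow> a) F"
  shows "((\<lambda>x. f x *\<^sub>R g x) \<longlongrightarrow> c *\<^sub>R a) F"
  using filterlim_compose[OF tendsto_scaleR_Pair, of "\<lambda>x. (f x, g x)" c a F] assms
  by (simp add: nhds_prod[symmetric] tendsto_Pair)

lemma continuous_on_scaleR_lcs:
  fixes g :: "'b::topological_space \<Rightarrow> 'a::locally_convex_space"
  assumes "continuous_on S f" "continuous_on S g"
  shows "continuous_on S (\<lambda>x. f x *\<^sub>R g x)"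
  using assms unfolding continuous_on_def by (auto intro: tendsto_scaleR_lcs)

instance real_normed_vector \<subseteq> locally_convex_space
proof (standard, fold convex_def)
  fix c :: real and a :: 'a
  have "((\<lambda>x. fst x *\<^sub>R snd x) \<longlongrightarrow> fst (c, a) *\<^sub>R snd (c, a)) (nhds (c, a))"
    by (intro tendsto_scaleR tendsto_fst tendsto_snd filterlim_ident)
  then show "LIM x (nhds c \<times>\<^sub>F nhds a). fst x *\<^sub>R snd x :> nhds (c *\<^sub>R a)"
    by (simp add: nhds_prod)
next
  fix U :: "'a set"
  assume "eventually (\<lambda>x. x \<in> U) (nhds 0)"
  then obtain e where "e > 0" "\<And>x. dist x 0 < e \<Longrightarrow> x \<in> U"
    by (auto simp: eventually_nhds_metric)
  moreover have "eventually (\<lambda>x. x \<in> ball 0 e) (nhds (0::'a))"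
    using \<open>e > 0\<close> by (intro eventually_nhds_in_open) auto
  ultimately show "\<exists>V. convex V \<and> V \<subseteq> U \<and> eventually (\<lambda>x. x \<in> V) (nhds 0)"
    by (intro exI[of _ "ball 0 e"]) (auto simp: dist_commute)
qed

instance prod :: (topological_monoid_add, topological_monoid_add) topological_monoid_add
proof
  fix a b :: "'a \<times> 'b"
  have "((\<lambda>x. (fst (fst x) + fst (snd x), snd (fst x) + snd (snd x))) \<longlongrightarrow>
     (fst (fst (a,b)) + fst (snd (a,b)), snd (fst (a,b)) + snd (snd (a,b)))) (nhds (a, b))"
    by (intro tendsto_intros filterlim_ident)
  then show "LIM x (nhds a \<times>\<^sub>F nhds b). fst x + snd x :> nhds (a + b)"
    by (simp add: nhds_prod plus_prod_def)
qed

instance prod :: (topological_comm_monoid_add, topological_comm_monoid_add) topological_comm_monoid_add ..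

instance prod :: (topological_group_add, topological_group_add) topological_group_add
proof
  fix a :: "'a \<times> 'b"
  have "((\<lambda>x. (- fst x, - snd x)) \<longlongrightarrow> (- fst a, - snd a)) (nhds a)"
    by (intro tendsto_intros filterlim_ident)
  then show "(uminus \<longlongrightarrow> - a) (nhds a)"
    by (simp add: uminus_prod_def[abs_def])
qed

instance prod :: (topological_ab_group_add, topological_ab_group_add) topological_ab_group_add ..

instance prod :: (locally_convex_space, locally_convex_space) locally_convex_space
proof (standard, fold convex_def)
  fix c :: real and a :: "'a \<times> 'b"
  have "((\<lambda>x. (fst x *\<^sub>R fst (snd x), fst x *\<^sub>R snd (snd x))) \<longlongrightarrow>
     (fst (c,a) *\<^sub>R fst (snd (c,a)), fst (c,a) *\<^sub>R snd (snd (c,a)))) (nhds (c, a))"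
    by (intro tendsto_intros tendsto_scaleR_lcs filterlim_ident)
  then show "LIM x (nhds c \<times>\<^sub>F nhds a). fst x *\<^sub>R snd x :> nhds (c *\<^sub>R a)"
    by (simp add: nhds_prod scaleR_prod_def)
next
  fix U :: "('a \<times> 'b) set"
  assume "eventually (\<lambda>x. x \<in> U) (nhds 0)"
  then obtain P Q where P: "eventually P (nhds 0)" and Q: "eventually Q (nhds 0)"
    and PQ: "\<And>x y. P x \<Longrightarrow> Q y \<Longrightarrow> (x, y) \<in> U"
    by (auto simp: zero_prod_def nhds_prod eventually_prod_filter)
  obtain V where V: "convex V" "V \<subseteq> Collect P" "eventually (\<lambda>x. x \<in> V) (nhds 0)"
    using locally_convex'[of "Collect P"] P by auto
  obtain W where W: "convex W" "W \<subseteq> Collect Q" "eventually (\<lambda>x. x \<in> W) (nhds 0)"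
    using locally_convex'[of "Collect Q"] Q by auto
  have "eventually (\<lambda>x. x \<in> V \<times> W) (nhds 0)"
    unfolding zero_prod_def nhds_prod eventually_prod_filter using V(3) W(3) by blast
  then show "\<exists>V. convex V \<and> V \<subseteq> U \<and> eventually (\<lambda>x. x \<in> V) (nhds 0)"
    using V W PQ by (intro exI[of _ "V \<times> W"]) (auto intro: convex_Times)
qed

text \<open>Arbitrary products, with the product topology.\<close>

lemma tendsto_fun_iff:
  fixes l :: "'i \<Rightarrow> 'b::topological_space"
  shows "(f \<longlongrightarrow> l) F \<longleftrightarrow> (\<forall>i. ((\<lambda>x. f x i) \<longlongrightarrow> l i) F)"
proof -
  have "limitin (product_topology (\<lambda>_. euclidean) UNIV) f l F \<longleftrightarrow>
        (\<forall>i. limitin euclidean (\<lambda>x. f x i) (l i) F)"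
    unfolding limitin_componentwise by simp
  then show ?thesis unfolding euclidean_product_topology by simp
qed

instantiation "fun" :: (type, real_vector) real_vector
begin

definition "r *\<^sub>R f = (\<lambda>x. r *\<^sub>R f x)"

instance
  by standard (auto simp: scaleR_fun_def algebra_simps)

end

lemma open_coordinate_vimage:
  fixes W :: "'b::topological_space set"
  shows "open W \<Longrightarrow> open {h :: 'a \<Rightarrow> 'b. h i \<in> W}"
  using product_topology_basis'[of "{()}" "\<lambda>_. W" "\<lambda>_. i"] by simp

instance "fun" :: (type, t0_space) t0_space
proof
  fix f g :: "'a \<Rightarrow> 'b"
  assume "f \<noteq> g"
  then obtain i where i: "f i \<noteq> g i" by auto
  obtain U where "open U" "\<not> (f i \<in> U \<longleftrightarrow> g i \<in> U)"
    using t0_space_class.t0_space[OF i] by blast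
  then show "\<exists>U. open U \<and> \<not> (f \<in> U \<longleftrightarrow> g \<in> U)"
    using open_coordinate_vimage[of U i] by (intro exI[of _ "{h. h i \<in> U}"]) simp
qed

instance "fun" :: (type, t1_space) t1_space
proof
  fix f g :: "'a \<Rightarrow> 'b"
  assume "f \<noteq> g"
  then obtain i where i: "f i \<noteq> g i" by auto
  obtain U where "open U" "f i \<in> U" "g i \<notin> U"
    using t1_space_class.t1_space[OF i] by blast
  then show "\<exists>U. open U \<and> f \<in> U \<and> g \<notin> U"
    using open_coordinate_vimage[of U i] by (intro exI[of _ "{h. h i \<in> U}"]) simp
qed

instance "fun" :: (type, t2_space) t2_space
proof
  fix f g :: "'a \<Rightarrow> 'b"
  assume "f \<noteq> g"
  then obtain i where i: "f i \<noteq> g i" by auto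
  obtain U V where "open U" "open V" "f i \<in> U" "g i \<in> V" "U \<inter> V = {}"
    using hausdorff[OF i] by blast
  then show "\<exists>U V. open U \<and> open V \<and> f \<in> U \<and> g \<in> V \<and> U \<inter> V = {}"
    using open_coordinate_vimage[of U i] open_coordinate_vimage[of V i]
    by (intro exI[of _ "{h. h i \<in> U}"] exI[of _ "{h. h i \<in> V}"]) auto
qed


lemma tendsto_coordinate:
  fixes l :: "'i \<Rightarrow> 'b::topological_space"
  shows "(f \<longlongrightarrow> l) F \<Longrightarrow> ((\<lambda>x. f x i) \<longlongrightarrow> l i) F"
  unfolding tendsto_fun_iff by (rule spec)

lemma tendsto_coordinatewise:
  fixes l :: "'i \<Rightarrow> 'b::topological_space"
  shows "(\<And>i. ((\<lambda>x. f x i) \<longlongrightarrow> l i) F) \<Longrightarrow> (f \<longlongrightarrow> l) F"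
  unfolding tendsto_fun_iff by (rule allI)

lemma tendsto_fst_nhds: "(fst \<longlongrightarrow> c) (nhds (c, d))"
  using tendsto_fst[OF filterlim_ident, of "(c, d)"] by simp

lemma tendsto_snd_nhds: "(snd \<longlongrightarrow> d) (nhds (c, d))"
  using tendsto_snd[OF filterlim_ident, of "(c, d)"] by simp



instance "fun" :: (type, topological_monoid_add) topological_monoid_add
proof
  fix a b :: "'a \<Rightarrow> 'b"
  have "((\<lambda>x. fst x + snd x) \<longlongrightarrow> a + b) (nhds (a, b))"
    unfolding plus_fun_def
    by (rule tendsto_coordinatewise, rule tendsto_add[OF tendsto_coordinate[OF tendsto_fst_nhds]
          tendsto_coordinate[OF tendsto_snd_nhds]])
  then show "LIM x (nhds a \<times>\<^sub>F nhds b). fst x + snd x :> nhds (a + b)"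
    unfolding nhds_prod .
qed

instance "fun" :: (type, topological_comm_monoid_add) topological_comm_monoid_add ..

instance "fun" :: (type, topological_group_add) topological_group_add
proof
  fix a :: "'a \<Rightarrow> 'b"
  show "(uminus \<longlongrightarrow> - a) (nhds a)"
    unfolding fun_Compl_def[abs_def]
    by (rule tendsto_coordinatewise, rule tendsto_minus[OF tendsto_coordinate[OF filterlim_ident]])
qed

instance "fun" :: (type, topological_ab_group_add) topological_ab_group_add ..
instance "fun" :: (type, locally_convex_space) locally_convex_space
proof (standard, fold convex_def)
  fix c :: real and a :: "'a \<Rightarrow> 'b"
  have "((\<lambda>x. fst x *\<^sub>R snd x) \<longlongrightarrow> c *\<^sub>R a) (nhds (c, a))"
    unfolding scaleR_fun_def
    by (rule tendsto_coordinatewise, rule tendsto_scaleR_lcs[OF tendsto_fst_nhds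
          tendsto_coordinate[OF tendsto_snd_nhds]])
  then show "LIM x (nhds c \<times>\<^sub>F nhds a). fst x *\<^sub>R snd x :> nhds (c *\<^sub>R a)"
    unfolding nhds_prod .
next
  fix U :: "('a \<Rightarrow> 'b) set"
  assume "eventually (\<lambda>x. x \<in> U) (nhds 0)"
  then have "\<exists>U'. open U' \<and> 0 \<in> U' \<and> U' \<subseteq> U"
    unfolding eventually_nhds subset_iff Ball_def .
  then obtain U' where U': "open U'" "0 \<in> U'" "U' \<subseteq> U"
    by (elim exE conjE)
  then obtain X where X: "0 \<in> Pi\<^sub>E UNIV X" "\<And>i. open (X i)" "finite {i. X i \<noteq> UNIV}" "Pi\<^sub>E UNIV X \<subseteq> U'"
    using product_topology_open_contains_basis[of "\<lambda>_::'a. euclidean::'b topology" UNIV U' 0]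
    unfolding open_fun_def by auto
  have "\<exists>V. convex V \<and> V \<subseteq> X i \<and> eventually (\<lambda>x. x \<in> V) (nhds 0)" for i
  proof (rule locally_convex', rule eventually_nhds_in_open)
    show "0 \<in> X i" using X(1) by (metis PiE_mem UNIV_I zero_fun_apply)
  qed (rule X(2))
  then obtain V where V: "\<And>i. convex (V i)" "\<And>i. V i \<subseteq> X i" "\<And>i. eventually (\<lambda>x. x \<in> V i) (nhds 0)"
    by metis
  define I where "I = {i. X i \<noteq> UNIV}"
  define W where "W = {h. \<forall>i\<in>I. h i \<in> V i}"
  have proj: "((\<lambda>x. x i) \<longlongrightarrow> 0) (nhds (0::'a \<Rightarrow> 'b))" for i
    using tendsto_coordinate[OF filterlim_ident, where l = "0::'a \<Rightarrow> 'b" and i = i]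
    unfolding zero_fun_apply .
  have "eventually (\<lambda>h. h i \<in> V i) (nhds 0)" for i
    by (rule eventually_compose_filterlim[OF V(3)[of i] proj[of i]])
  then have "eventually (\<lambda>h. h \<in> W) (nhds 0)"
    unfolding W_def mem_Collect_eq using X(3) by (intro eventually_ball_finite ballI) (simp add: I_def)
  moreover have "W \<subseteq> U"
  proof
    fix h assume h: "h \<in> W"
    have "h i \<in> X i" for i
    proof (cases "i \<in> I")
      case True
      then have "h i \<in> V i" using h by (simp add: W_def)
      then show ?thesis using V(2)[of i] by (rule rev_subsetD)
    qed (simp add: I_def)
    then have "h \<in> Pi\<^sub>E UNIV X" by (simp add: PiE_iff)
    with X(4) U'(3) show "h \<in> U" by (meson subsetD)
  qed
  moreover have "convex W"
    using V(1) unfolding W_def convex_def by (simp add: scaleR_fun_def)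
  ultimately show "\<exists>V. convex V \<and> V \<subseteq> U \<and> eventually (\<lambda>x. x \<in> V) (nhds 0)"
    by (intro exI[of _ W] conjI)
qed

section \<open>Smooth maps in the sense of Michal and Bastiani\<close>

definition dir_quotient :: "('a::real_vector \<Rightarrow> 'b::real_vector) \<Rightarrow> 'a \<Rightarrow> 'a \<Rightarrow> real \<Rightarrow> 'b" where
  "dir_quotient f x v t = (f (x + t *\<^sub>R v) - f x) /\<^sub>R t"

definition dir_filter :: "'a::real_vector set \<Rightarrow> 'a \<Rightarrow> 'a \<Rightarrow> real filter" where
  "dir_filter S x v = at 0 within {t. x + t *\<^sub>R v \<in> S}"

text \<open>
  Derivative at \<open>x\<close> in direction \<open>v\<close>, the limit being taken over the \<open>t \<noteq> 0\<close> with
  \<open>x + t v \<in> S\<close>. At interior points of \<open>S\<close> this is the two-sided derivative (so \<open>S = UNIV\<close>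
  computes the derivative of any function that is only relevant near \<open>x\<close>); at the end points
  of \<open>S = {0..1}\<close> it is one-sided.
\<close>

definition dir_deriv :: "'a::real_vector set \<Rightarrow> ('a \<Rightarrow> 'b::{real_vector,t2_space}) \<Rightarrow> 'a \<Rightarrow> 'a \<Rightarrow> 'b" where
  "dir_deriv S f x v = Lim (dir_filter S x v) (dir_quotient f x v)"

text \<open>
  The iterated derivative in the directions \<open>v 0, \<dots>, v (k - 1)\<close>. Only these entries of
  the sequence \<open>v\<close> matter, so continuity in \<open>(x, v)\<close> for the product topology on sequences is
  joint continuity in \<open>(x, v 0, \<dots>, v (k - 1))\<close>.
\<close>

primrec iter_dir_deriv ::
    "'a::real_vector set \<Rightarrow> ('a \<Rightarrow> 'b::{real_vector,t2_space}) \<Rightarrow> nat \<Rightarrow> 'a \<Rightarrow> (nat \<Rightarrow> 'a) \<Rightarrow> 'b" where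
  "iter_dir_deriv S f 0 x v = f x"
| "iter_dir_deriv S f (Suc k) x v = dir_deriv S (\<lambda>y. iter_dir_deriv S f k y v) x (v k)"

text \<open>
  \<open>smooth_on W S f\<close>: all iterated directional derivatives of \<open>f\<close> on \<open>S\<close> in directions from
  \<open>W\<close> exist and are jointly continuous. The set \<open>W\<close> is the linear subspace on which \<open>f\<close> lives,
  and \<open>S\<close> is meant to be relatively open in \<open>W\<close>, or to be relatively open in \<open>{0..1}\<close>
  with \<open>W = (UNIV :: real set)\<close>.
\<close>

definition smooth_on ::
    "'a::locally_convex_space set \<Rightarrow> 'a set \<Rightarrow> ('a \<Rightarrow> 'b::locally_convex_space) \<Rightarrow> bool" where
  "smooth_on W S f \<longleftrightarrow> (\<forall>k.
     (\<forall>x\<in>S. \<forall>v\<in>UNIV \<rightarrow> W. \<exists>l.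
        (dir_quotient (\<lambda>y. iter_dir_deriv S f k y v) x (v k) \<longlongrightarrow> l) (dir_filter S x (v k))) \<and>
     continuous_on (S \<times> (UNIV \<rightarrow> W)) (\<lambda>(x, v). iter_dir_deriv S f k x v))"

lemma dir_quotient_lincomb:
  fixes f g h :: "'a::real_vector \<Rightarrow> 'b::locally_convex_space"
  assumes x: "x \<in> S" and h: "\<And>y. y \<in> S \<Longrightarrow> h y = a *\<^sub>R f y + b *\<^sub>R g y"
    and f: "(dir_quotient f x w \<longlongrightarrow> l) (dir_filter S x w)"
    and g: "(dir_quotient g x w \<longlongrightarrow> m) (dir_filter S x w)"
  shows "(dir_quotient h x w \<longlongrightarrow> a *\<^sub>R l + b *\<^sub>R m) (dir_filter S x w)"
proof -
  have ev: "\<forall>\<^sub>F t in dir_filter S x w. x + t *\<^sub>R w \<in> S"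
    unfolding dir_filter_def eventually_at_topological by auto
  have "\<forall>\<^sub>F t in dir_filter S x w.
      dir_quotient h x w t = a *\<^sub>R dir_quotient f x w t + b *\<^sub>R dir_quotient g x w t"
    using ev by eventually_elim (simp add: dir_quotient_def h x algebra_simps)
  moreover have "((\<lambda>t. a *\<^sub>R dir_quotient f x w t + b *\<^sub>R dir_quotient g x w t)
      \<longlongrightarrow> a *\<^sub>R l + b *\<^sub>R m) (dir_filter S x w)"
    by (intro tendsto_add tendsto_scaleR_lcs tendsto_const f g)
  ultimately show ?thesis by (simp add: tendsto_cong)
qed

lemma smooth_on_lincomb:
  fixes f g :: "'a::locally_convex_space \<Rightarrow> 'b::locally_convex_space"
  assumes f: "smooth_on W S f" and g: "smooth_on W S g"
    and nontriv: "\<And>x w. x \<in> S \<Longrightarrow> w \<in> W \<Longrightarrow> dir_filter S x w \<noteq> bot"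
  shows iter_dir_deriv_lincomb: "x \<in> S \<Longrightarrow> v \<in> UNIV \<rightarrow> W \<Longrightarrow>
      iter_dir_deriv S (\<lambda>y. a *\<^sub>R f y + b *\<^sub>R g y) k x v =
      a *\<^sub>R iter_dir_deriv S f k x v + b *\<^sub>R iter_dir_deriv S g k x v"
    and "smooth_on W S (\<lambda>y. a *\<^sub>R f y + b *\<^sub>R g y)"
proof -
  let ?h = "\<lambda>y. a *\<^sub>R f y + b *\<^sub>R g y"
  have step: "(dir_quotient (\<lambda>y. iter_dir_deriv S ?h k y v) x (v k) \<longlongrightarrow>
      a *\<^sub>R iter_dir_deriv S f (Suc k) x v + b *\<^sub>R iter_dir_deriv S g (Suc k) x v) (dir_filter S x (v k))"
    if x: "x \<in> S" and v: "v \<in> UNIV \<rightarrow> W"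
      and IH: "\<And>y. y \<in> S \<Longrightarrow> iter_dir_deriv S ?h k y v =
        a *\<^sub>R iter_dir_deriv S f k y v + b *\<^sub>R iter_dir_deriv S g k y v" for x v k
  proof -
    have nt: "dir_filter S x (v k) \<noteq> bot" using x v by (intro nontriv) auto
    obtain l m where
      l: "(dir_quotient (\<lambda>y. iter_dir_deriv S f k y v) x (v k) \<longlongrightarrow> l) (dir_filter S x (v k))" and
      m: "(dir_quotient (\<lambda>y. iter_dir_deriv S g k y v) x (v k) \<longlongrightarrow> m) (dir_filter S x (v k))"
      using f g x v unfolding smooth_on_def by meson
    have "iter_dir_deriv S f (Suc k) x v = l" "iter_dir_deriv S g (Suc k) x v = m"
      using tendsto_Lim[OF nt l] tendsto_Lim[OF nt m] by (simp_all add: dir_deriv_def)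
    then show ?thesis using dir_quotient_lincomb[OF x IH l m] by simp
  qed
  have eq: "x \<in> S \<Longrightarrow> v \<in> UNIV \<rightarrow> W \<Longrightarrow> iter_dir_deriv S ?h k x v =
      a *\<^sub>R iter_dir_deriv S f k x v + b *\<^sub>R iter_dir_deriv S g k x v" for k x v
  proof (induction k arbitrary: x)
    case (Suc k)
    have nt: "dir_filter S x (v k) \<noteq> bot" using Suc.prems by (intro nontriv) auto
    show ?case
      using tendsto_Lim[OF nt step[OF Suc.prems Suc.IH[OF _ Suc.prems(2)]]]
      by (simp add: dir_deriv_def)
  qed simp
  then show "x \<in> S \<Longrightarrow> v \<in> UNIV \<rightarrow> W \<Longrightarrow> iter_dir_deriv S ?h k x v =
      a *\<^sub>R iter_dir_deriv S f k x v + b *\<^sub>R iter_dir_deriv S g k x v" .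
  show "smooth_on W S ?h"
    unfolding smooth_on_def
  proof (intro allI conjI ballI)
    fix k x and v :: "nat \<Rightarrow> 'a" assume "x \<in> S" "v \<in> UNIV \<rightarrow> W"
    then show "\<exists>l. (dir_quotient (\<lambda>y. iter_dir_deriv S ?h k y v) x (v k) \<longlongrightarrow> l) (dir_filter S x (v k))"
      using step[of x v k] eq by blast
  next
    fix k
    have "continuous_on (S \<times> (UNIV \<rightarrow> W)) (\<lambda>(x, v). iter_dir_deriv S f k x v)"
      "continuous_on (S \<times> (UNIV \<rightarrow> W)) (\<lambda>(x, v). iter_dir_deriv S g k x v)"
      using f g by (auto simp: smooth_on_def)
    then have "continuous_on (S \<times> (UNIV \<rightarrow> W))
        (\<lambda>p. a *\<^sub>R (case p of (x, v) \<Rightarrow> iter_dir_deriv S f k x v) +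
             b *\<^sub>R (case p of (x, v) \<Rightarrow> iter_dir_deriv S g k x v))"
      by (intro continuous_on_add continuous_on_scaleR_lcs continuous_on_const)
    then show "continuous_on (S \<times> (UNIV \<rightarrow> W)) (\<lambda>(x, v). iter_dir_deriv S ?h k x v)"
      by (rule continuous_on_eq) (auto simp: eq)
  qed
qed

lemma smooth_on_zero:
  fixes W S :: "'a::locally_convex_space set"
  assumes nontriv: "\<And>x w. x \<in> S \<Longrightarrow> w \<in> W \<Longrightarrow> dir_filter S x w \<noteq> bot"
  shows "smooth_on W S (\<lambda>_. 0 :: 'b::locally_convex_space)"
proof -
  have eq: "x \<in> S \<Longrightarrow> v \<in> UNIV \<rightarrow> W \<Longrightarrow>
      iter_dir_deriv S (\<lambda>_. 0 :: 'b) k x v = 0" for k x v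
  proof (induction k arbitrary: x)
    case (Suc k)
    have nt: "dir_filter S x (v k) \<noteq> bot" using Suc.prems by (intro nontriv) auto
    have "(dir_quotient (\<lambda>y. iter_dir_deriv S (\<lambda>_. 0 :: 'b) k y v) x (v k) \<longlongrightarrow> 0 *\<^sub>R 0 + 0 *\<^sub>R 0)
        (dir_filter S x (v k))"
      using Suc by (intro dir_quotient_lincomb[of _ _ _ _ "\<lambda>_. 0" _ "\<lambda>_. 0"])
        (auto simp: dir_quotient_def[abs_def])
    from tendsto_Lim[OF nt this] show ?case by (simp add: dir_deriv_def)
  qed simp
  show ?thesis
    unfolding smooth_on_def
  proof (intro allI conjI ballI)
    fix k x and v :: "nat \<Rightarrow> 'a" assume *: "x \<in> S" "v \<in> UNIV \<rightarrow> W"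
    have "(dir_quotient (\<lambda>y. iter_dir_deriv S (\<lambda>_. 0 :: 'b) k y v) x (v k) \<longlongrightarrow> 0 *\<^sub>R 0 + 0 *\<^sub>R 0)
        (dir_filter S x (v k))"
      using * eq by (intro dir_quotient_lincomb[of _ _ _ _ "\<lambda>_. 0" _ "\<lambda>_. 0"])
        (auto simp: dir_quotient_def[abs_def])
    then show "\<exists>l. (dir_quotient (\<lambda>y. iter_dir_deriv S (\<lambda>_. 0 :: 'b) k y v) x (v k) \<longlongrightarrow> l) (dir_filter S x (v k))"
      by blast
  next
    fix k
    show "continuous_on (S \<times> (UNIV \<rightarrow> W)) (\<lambda>(x, v). iter_dir_deriv S (\<lambda>_. 0 :: 'b) k x v)"
      by (rule continuous_on_eq[OF continuous_on_const[of _ 0]]) (auto simp: eq)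
  qed
qed

lemma dir_filter_unit_interval_nontriv:
  assumes "x \<in> {0..1::real}"
  shows "dir_filter {0..1} x w \<noteq> bot"
proof -
  define a where "a = (if x < 1 / 2 then 1 / 2 else - 1 / 2 :: real)"
  define b where "b = (if w = 0 then 1 else a / w)"
  have b: "b \<noteq> 0" "b * w = a \<or> w = 0" by (auto simp: b_def a_def)
  have mem: "x + (s * b) * w \<in> {0..1}" if "0 < s" "s \<le> 1" for s
  proof (cases "w = 0")
    case False
    then have sw: "(s * b) * w = s * a" using b(2) by simp
    show ?thesis
    proof (cases "x < 1 / 2")
      case True
      then show ?thesis unfolding sw using assms that by (simp add: a_def)
    next
      case False
      then show ?thesis unfolding sw using assms that by (simp add: a_def)
    qed
  qed (use assms in simp)
  have "(\<lambda>n. inverse (real (Suc n)) * b) \<longlonglongrightarrow> 0 * b"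
    by (intro tendsto_mult LIMSEQ_inverse_real_of_nat tendsto_const)
  moreover have "inverse (real (Suc n)) * b \<in> {t. x + t *\<^sub>R w \<in> {0..1}} - {0}" for n
    using mem[of "inverse (real (Suc n))"] b(1) by (auto simp: inverse_le_1_iff)
  ultimately have "0 \<in> closure ({t. x + t *\<^sub>R w \<in> {0..1}} - {0})"
    unfolding closure_sequential by (intro exI[of _ "\<lambda>n. inverse (real (Suc n)) * b"]) auto
  then show ?thesis by (simp add: dir_filter_def at_within_eq_bot_iff)
qed

section \<open>The locally convex space of smooth curves\<close>

lemma smooth_on_curve_zero: "smooth_on UNIV {0..1::real} (\<lambda>_. 0)"
  by (rule smooth_on_zero[OF dir_filter_unit_interval_nontriv])

lemma smooth_on_curve_lincomb:
  assumes "smooth_on UNIV {0..1::real} f" "smooth_on UNIV {0..1} g"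
  shows iter_dir_deriv_curve_lincomb: "t \<in> {0..1} \<Longrightarrow>
      iter_dir_deriv {0..1} (\<lambda>y. a *\<^sub>R f y + b *\<^sub>R g y) k t v =
      a *\<^sub>R iter_dir_deriv {0..1} f k t v + b *\<^sub>R iter_dir_deriv {0..1} g k t v"
    and "smooth_on UNIV {0..1} (\<lambda>y. a *\<^sub>R f y + b *\<^sub>R g y)"
proof -
  show "smooth_on UNIV {0..1} (\<lambda>y. a *\<^sub>R f y + b *\<^sub>R g y)"
    by (rule smooth_on_lincomb(2)[OF assms]) (rule dir_filter_unit_interval_nontriv)
  show "t \<in> {0..1} \<Longrightarrow>
      iter_dir_deriv {0..1} (\<lambda>y. a *\<^sub>R f y + b *\<^sub>R g y) k t v =
      a *\<^sub>R iter_dir_deriv {0..1} f k t v + b *\<^sub>R iter_dir_deriv {0..1} g k t v"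
    by (rule iter_dir_deriv_lincomb[OF assms]) (simp_all add: dir_filter_unit_interval_nontriv del: atLeastAtMost_iff)
qed

text \<open>
  The space of smooth curves \<open>[0,1] \<rightarrow> 'a\<close>. A curve is represented by its extension by zero.
\<close>

typedef (overloaded) ('a::locally_convex_space) smooth_curve =
  "{c :: real \<Rightarrow> 'a. smooth_on UNIV {0..1} c \<and> (\<forall>t. t \<notin> {0..1} \<longrightarrow> c t = 0)}"
  morphisms curve_at Abs_smooth_curve
  by (rule exI[of _ "\<lambda>_. 0"]) (simp add: smooth_on_curve_zero)

setup_lifting type_definition_smooth_curve

instantiation smooth_curve :: (locally_convex_space) real_vector
begin

lift_definition zero_smooth_curve :: "'a smooth_curve" is "\<lambda>_. 0"
  by (simp add: smooth_on_curve_zero)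

lift_definition plus_smooth_curve :: "'a smooth_curve \<Rightarrow> 'a smooth_curve \<Rightarrow> 'a smooth_curve"
  is "\<lambda>c d t. c t + d t"
  using smooth_on_curve_lincomb(2)[of f g 1 1 for f g :: "real \<Rightarrow> 'a"] by simp

lift_definition scaleR_smooth_curve :: "real \<Rightarrow> 'a smooth_curve \<Rightarrow> 'a smooth_curve"
  is "\<lambda>r c t. r *\<^sub>R c t"
  using smooth_on_curve_lincomb(2)[of f f r 0 for r and f :: "real \<Rightarrow> 'a"] by simp

definition uminus_smooth_curve :: "'a smooth_curve \<Rightarrow> 'a smooth_curve" where
  "- c = (- 1) *\<^sub>R c" for c :: "'a smooth_curve"

definition minus_smooth_curve :: "'a smooth_curve \<Rightarrow> 'a smooth_curve \<Rightarrow> 'a smooth_curve" where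
  "c - d = c + - d" for c d :: "'a smooth_curve"

instance
  by standard (simp_all add: uminus_smooth_curve_def minus_smooth_curve_def, (transfer, force simp: algebra_simps)+)

end

definition curve_deriv :: "nat \<Rightarrow> 'a::locally_convex_space smooth_curve \<Rightarrow> real \<Rightarrow> 'a" where
  "curve_deriv k c t = iter_dir_deriv {0..1} (curve_at c) k t (\<lambda>_. 1)"

definition curve_nhd :: "nat \<Rightarrow> 'a::locally_convex_space set \<Rightarrow> 'a smooth_curve set" where
  "curve_nhd n V = {c. \<forall>k\<le>n. \<forall>t\<in>{0..1}. curve_deriv k c t \<in> V}"

lemma curve_deriv_lincomb:
  assumes "t \<in> {0..1}"
  shows "curve_deriv k (a *\<^sub>R c + b *\<^sub>R d) t = a *\<^sub>R curve_deriv k c t + b *\<^sub>R curve_deriv k d t"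
proof -
  have "curve_at (a *\<^sub>R c + b *\<^sub>R d) = (\<lambda>t. a *\<^sub>R curve_at c t + b *\<^sub>R curve_at d t)"
    by (simp add: plus_smooth_curve.rep_eq scaleR_smooth_curve.rep_eq)
  then show ?thesis
    unfolding curve_deriv_def using curve_at[of c] curve_at[of d]
    by (simp only: mem_Collect_eq iter_dir_deriv_curve_lincomb[OF _ _ assms])
qed

lemma curve_deriv_add: "t \<in> {0..1} \<Longrightarrow> curve_deriv k (c + d) t = curve_deriv k c t + curve_deriv k d t"
  using curve_deriv_lincomb[of t k 1 c 1 d] by simp

lemma curve_deriv_scaleR: "t \<in> {0..1} \<Longrightarrow> curve_deriv k (a *\<^sub>R c) t = a *\<^sub>R curve_deriv k c t"
  using curve_deriv_lincomb[of t k a c 0 c] by simp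

lemma curve_deriv_uminus: "t \<in> {0..1} \<Longrightarrow> curve_deriv k (- c) t = - curve_deriv k c t"
  using curve_deriv_scaleR[of t k "- 1" c] by simp

lemma curve_deriv_zero: "t \<in> {0..1} \<Longrightarrow> curve_deriv k 0 t = 0"
  using curve_deriv_scaleR[of t k 0 0] by simp

lemma continuous_on_curve_deriv: "continuous_on {0..1} (curve_deriv k c)"
proof -
  have "continuous_on ({0..1} \<times> UNIV) (\<lambda>(x, v). iter_dir_deriv {0..1} (curve_at c) k x v)"
    using curve_at[of c] by (simp add: smooth_on_def)
  then have "continuous_on {0..1} (\<lambda>t. (\<lambda>(x, v). iter_dir_deriv {0..1} (curve_at c) k x v) (t, \<lambda>_. 1))"
    by (rule continuous_on_compose2[where f = "\<lambda>t. (t, \<lambda>_. 1)"]) (auto intro!: continuous_intros)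
  then show ?thesis by (simp add: curve_deriv_def[abs_def])
qed

lemma nhds_zero_add_halves:
  assumes "eventually (\<lambda>x. x \<in> V) (nhds (0::'a::topological_monoid_add))"
  obtains W where "eventually (\<lambda>x. x \<in> W) (nhds 0)" "\<And>x y. x \<in> W \<Longrightarrow> y \<in> W \<Longrightarrow> x + y \<in> V"
proof -
  have "\<forall>\<^sub>F x in nhds 0 \<times>\<^sub>F nhds 0. fst x + snd x \<in> V"
    using eventually_compose_filterlim[OF _ tendsto_add_Pair, of "\<lambda>x. x \<in> V" 0 0] assms by simp
  then obtain P Q where "eventually P (nhds 0)" "eventually Q (nhds 0)"
    "\<And>x y. P x \<Longrightarrow> Q y \<Longrightarrow> x + y \<in> V"
    unfolding eventually_prod_filter by auto
  then show ?thesis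
    by (intro that[of "{x. P x \<and> Q x}"]) (auto intro: eventually_conj)
qed

text \<open>The topology of uniform convergence of all derivatives on \<open>[0,1]\<close>.\<close>

instantiation smooth_curve :: (locally_convex_space) topological_space
begin

definition open_smooth_curve :: "'a smooth_curve set \<Rightarrow> bool" where
  "open S \<longleftrightarrow> (\<forall>c\<in>S. \<exists>n V. eventually (\<lambda>x. x \<in> V) (nhds 0) \<and> (\<forall>d. d - c \<in> curve_nhd n V \<longrightarrow> d \<in> S))"

lemma curve_nhd_Int: "curve_nhd (max n m) (V \<inter> W) \<subseteq> curve_nhd n V \<inter> curve_nhd m W"
  by (auto simp: curve_nhd_def)

instance
proof
  show "open (UNIV :: 'a smooth_curve set)"
    by (auto simp: open_smooth_curve_def intro!: exI[of _ UNIV])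
next
  fix S T :: "'a smooth_curve set" assume S: "open S" and T: "open T"
  show "open (S \<inter> T)"
    unfolding open_smooth_curve_def
  proof
    fix c assume "c \<in> S \<inter> T"
    then obtain n V m W where
      "eventually (\<lambda>x. x \<in> V) (nhds 0)" "\<And>d. d - c \<in> curve_nhd n V \<Longrightarrow> d \<in> S"
      "eventually (\<lambda>x. x \<in> W) (nhds 0)" "\<And>d. d - c \<in> curve_nhd m W \<Longrightarrow> d \<in> T"
      using S T unfolding open_smooth_curve_def by (metis IntD1 IntD2)
    then show "\<exists>n V. eventually (\<lambda>x. x \<in> V) (nhds 0) \<and> (\<forall>d. d - c \<in> curve_nhd n V \<longrightarrow> d \<in> S \<inter> T)"
      using curve_nhd_Int[of n m V W]
      by (intro exI[of _ "max n m"] exI[of _ "V \<inter> W"]) (auto intro: eventually_conj)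
  qed
next
  fix K :: "'a smooth_curve set set" assume K: "\<forall>S\<in>K. open S"
  show "open (\<Union>K)"
    unfolding open_smooth_curve_def
  proof
    fix c assume "c \<in> \<Union>K"
    then obtain S where S: "S \<in> K" "c \<in> S" by auto
    with K obtain n V where "eventually (\<lambda>x. x \<in> V) (nhds 0)" "\<And>d. d - c \<in> curve_nhd n V \<Longrightarrow> d \<in> S"
      unfolding open_smooth_curve_def by metis
    with S show "\<exists>n V. eventually (\<lambda>x. x \<in> V) (nhds 0) \<and> (\<forall>d. d - c \<in> curve_nhd n V \<longrightarrow> d \<in> \<Union>K)"
      by blast
  qed
qed

end

lemma eventually_nhds_smooth_curve:
  "eventually P (nhds c) \<longleftrightarrow>
   (\<exists>n V. eventually (\<lambda>x. x \<in> V) (nhds 0) \<and> (\<forall>d. d - c \<in> curve_nhd n V \<longrightarrow> P d))"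
    (is "_ \<longleftrightarrow> ?R c")
proof
  assume "eventually P (nhds c)"
  then show "?R c" unfolding eventually_nhds open_smooth_curve_def by meson
next
  assume "?R c"
  have self: "c \<in> {d. ?R d} \<Longrightarrow> P c" for c
  proof -
    assume "c \<in> {d. ?R d}"
    then obtain n V where V: "eventually (\<lambda>x. x \<in> V) (nhds 0)" "\<And>d. d - c \<in> curve_nhd n V \<Longrightarrow> P d"
      by auto
    have "0 \<in> V" using eventually_nhds_x_imp_x[OF V(1)] .
    then show "P c" by (intro V(2)) (simp add: curve_nhd_def curve_deriv_zero)
  qed
  have "open {d. ?R d}"
    unfolding open_smooth_curve_def
  proof
    fix d assume "d \<in> {d. ?R d}"
    then obtain n V where V: "eventually (\<lambda>x. x \<in> V) (nhds 0)" "\<And>e. e - d \<in> curve_nhd n V \<Longrightarrow> P e"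
      by auto
    obtain W where W: "eventually (\<lambda>x. x \<in> W) (nhds 0)" "\<And>x y. x \<in> W \<Longrightarrow> y \<in> W \<Longrightarrow> x + y \<in> V"
      using nhds_zero_add_halves[OF V(1)] by blast
    have "?R d'" if d': "d' - d \<in> curve_nhd n W" for d'
    proof (intro exI conjI allI impI)
      show "eventually (\<lambda>x. x \<in> W) (nhds 0)" by fact
      fix e assume e: "e - d' \<in> curve_nhd n W"
      have "curve_deriv k (e - d) t \<in> V" if "k \<le> n" "t \<in> {0..1}" for k t
        using curve_deriv_add[OF that(2), of k "e - d'" "d' - d"] d' e that W(2)
        by (auto simp: curve_nhd_def)
      then show "P e" by (intro V(2)) (auto simp: curve_nhd_def)
    qed
    with W(1) show "\<exists>n V. eventually (\<lambda>x. x \<in> V) (nhds 0) \<and>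
        (\<forall>d'. d' - d \<in> curve_nhd n V \<longrightarrow> d' \<in> {d. ?R d})"
      by blast
  qed
  moreover have "c \<in> {d. ?R d}" using \<open>?R c\<close> by (rule CollectI)
  ultimately show "eventually P (nhds c)"
    unfolding eventually_nhds[of P c] using self by (intro exI[of _ "{d. ?R d}"] conjI ballI)
qed

lemma eventually_nhds_smooth_curveE:
  assumes "eventually P (nhds c)"
  obtains n V where "eventually (\<lambda>x. x \<in> V) (nhds 0)" "\<And>d. d - c \<in> curve_nhd n V \<Longrightarrow> P d"
  using assms unfolding eventually_nhds_smooth_curve by (elim exE conjE) (rule that, assumption, drule spec, erule mp)

lemma tendsto_curve_at:
  assumes "t \<in> {0..1}"
  shows "((\<lambda>c. curve_at c t) \<longlongrightarrow> curve_at c t) (nhds c)"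
proof (rule topological_tendstoI)
  fix U assume U: "open U" "curve_at c t \<in> U"
  have lim: "((\<lambda>x. curve_at c t + x) \<longlongrightarrow> curve_at c t + 0) (nhds 0)"
    by (intro tendsto_intros filterlim_ident)
  have "eventually (\<lambda>x. x \<in> {x. curve_at c t + x \<in> U}) (nhds 0)"
    using topological_tendstoD[OF lim U(1)] U(2) by simp
  moreover have "curve_at d t \<in> U" if "d - c \<in> curve_nhd 0 {x. curve_at c t + x \<in> U}" for d
  proof -
    have "curve_at (c + (d - c)) t = curve_at c t + curve_at (d - c) t"
      by (simp only: plus_smooth_curve.rep_eq)
    moreover have "curve_at c t + curve_at (d - c) t \<in> U"
      using that assms by (simp add: curve_nhd_def curve_deriv_def)
    ultimately show ?thesis by simp
  qed
  ultimately show "\<forall>\<^sub>F d in nhds c. curve_at d t \<in> U"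
    unfolding eventually_nhds_smooth_curve by (intro exI conjI allI impI)
qed

instance smooth_curve :: (locally_convex_space) locally_convex_space
proof (standard, fold convex_def)
  fix a b :: "'a smooth_curve"
  show "LIM x (nhds a \<times>\<^sub>F nhds b). fst x + snd x :> nhds (a + b)"
    unfolding filterlim_iff
  proof (intro allI impI)
    fix P assume "eventually P (nhds (a + b))"
    then obtain n V where V: "eventually (\<lambda>x. x \<in> V) (nhds 0)" "\<And>d. d - (a + b) \<in> curve_nhd n V \<Longrightarrow> P d"
      by (rule eventually_nhds_smooth_curveE) (rule that)
    obtain W where W: "eventually (\<lambda>x. x \<in> W) (nhds 0)" "\<And>x y. x \<in> W \<Longrightarrow> y \<in> W \<Longrightarrow> x + y \<in> V"
      using nhds_zero_add_halves[OF V(1)] by blast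
    have "P (c + d)" if "c - a \<in> curve_nhd n W" "d - b \<in> curve_nhd n W" for c d
    proof (rule V(2))
      have *: "c + d - (a + b) = (c - a) + (d - b)" by simp
      show "c + d - (a + b) \<in> curve_nhd n V"
        unfolding * using that W(2) by (auto simp: curve_nhd_def curve_deriv_add)
    qed
    moreover have "\<forall>\<^sub>F c in nhds a. c - a \<in> curve_nhd n W" for a
      unfolding eventually_nhds_smooth_curve using W(1) by (intro exI conjI allI impI)
    ultimately show "\<forall>\<^sub>F x in nhds a \<times>\<^sub>F nhds b. P (fst x + snd x)"
      unfolding eventually_prod_filter
      by (intro exI[of _ "\<lambda>c. c - a \<in> curve_nhd n W"] exI[of _ "\<lambda>d. d - b \<in> curve_nhd n W"]) simp
  qed
next
  fix a :: "'a smooth_curve"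
  show "(uminus \<longlongrightarrow> - a) (nhds a)"
    unfolding filterlim_iff
  proof (intro allI impI)
    fix P assume "eventually P (nhds (- a))"
    then obtain n V where V: "eventually (\<lambda>x. x \<in> V) (nhds 0)" "\<And>d. d - (- a) \<in> curve_nhd n V \<Longrightarrow> P d"
      by (rule eventually_nhds_smooth_curveE) (rule that)
    have "((\<lambda>x. - x) \<longlongrightarrow> - 0) (nhds (0::'a))" by (intro tendsto_intros filterlim_ident)
    then have "eventually (\<lambda>x. x \<in> {x. - x \<in> V}) (nhds 0)"
      using eventually_compose_filterlim[OF V(1), of uminus "nhds 0"] by simp
    moreover have "P (- c)" if "c - a \<in> curve_nhd n {x. - x \<in> V}" for c
    proof (rule V(2))
      have *: "- c - (- a) = - (c - a)" by simp
      show "- c - (- a) \<in> curve_nhd n V"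
        unfolding * using that by (simp add: curve_nhd_def curve_deriv_uminus del: minus_diff_eq)
    qed
    ultimately show "\<forall>\<^sub>F c in nhds a. P (- c)"
      unfolding eventually_nhds_smooth_curve by (intro exI conjI allI impI)
  qed
next
  fix r :: real and a :: "'a smooth_curve"
  show "LIM x (nhds r \<times>\<^sub>F nhds a). fst x *\<^sub>R snd x :> nhds (r *\<^sub>R a)"
    unfolding filterlim_iff
  proof (intro allI impI)
    fix P assume "eventually P (nhds (r *\<^sub>R a))"
    then obtain n V where V: "eventually (\<lambda>x. x \<in> V) (nhds 0)" "\<And>d. d - r *\<^sub>R a \<in> curve_nhd n V \<Longrightarrow> P d"
      by (rule eventually_nhds_smooth_curveE) (rule that)
    obtain W where W: "eventually (\<lambda>x. x \<in> W) (nhds 0)" "\<And>x y. x \<in> W \<Longrightarrow> y \<in> W \<Longrightarrow> x + y \<in> V"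
      using nhds_zero_add_halves[OF V(1)] by blast
    have "\<forall>\<^sub>F p in nhds r \<times>\<^sub>F nhds 0. fst p *\<^sub>R snd p \<in> W"
      using eventually_compose_filterlim[OF _ tendsto_scaleR_Pair, of "\<lambda>x. x \<in> W" r 0] W(1) by simp
    then obtain Q Q' where Q: "eventually Q (nhds r)" and Q': "eventually Q' (nhds 0)"
      and QQ': "\<And>s x. Q s \<Longrightarrow> Q' x \<Longrightarrow> s *\<^sub>R x \<in> W"
      unfolding eventually_prod_filter by auto
    define V' where "V' = {x. Q' x}"
    have V': "eventually (\<lambda>x. x \<in> V') (nhds 0)" using Q' by (simp add: V'_def)
    have QV: "\<And>s x. Q s \<Longrightarrow> x \<in> V' \<Longrightarrow> s *\<^sub>R x \<in> W" using QQ' by (simp add: V'_def)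
    have "\<forall>\<^sub>F s in nhds r. \<forall>t\<in>{0..1}. (s - r) *\<^sub>R curve_deriv k a t \<in> W" for k
    proof -
      obtain W' where W': "open W'" "0 \<in> W'" "W' \<subseteq> W"
        using W(1) unfolding eventually_nhds by blast
      have "continuous_on (UNIV \<times> {0..1}) (\<lambda>p. (fst p - r) *\<^sub>R curve_deriv k a (snd p))"
        by (intro continuous_on_scaleR_lcs continuous_intros
            continuous_on_compose2[OF continuous_on_curve_deriv]) auto
      then have "openin (top_of_set (UNIV \<times> {0..1}))
          ((UNIV \<times> {0..1}) \<inter> (\<lambda>p. (fst p - r) *\<^sub>R curve_deriv k a (snd p)) -` W')"
        using W'(1) continuous_openin_preimage_gen by blast
      then have op: "openin (prod_topology euclidean (top_of_set {0..1}))
          ((UNIV \<times> {0..1}) \<inter> (\<lambda>p. (fst p - r) *\<^sub>R curve_deriv k a (snd p)) -` W')"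
        using prod_topology_subtopology_eu[of "UNIV :: real set" "{0..1} :: real set"]
        by (simp only: subtopology_UNIV)
      have sub: "{r} \<times> {0..1} \<subseteq>
          (UNIV \<times> {0..1}) \<inter> (\<lambda>p. (fst p - r) *\<^sub>R curve_deriv k a (snd p)) -` W'"
        using W'(2) by auto
      have co: "compactin (top_of_set {0..1::real}) {0..1}"
        by (simp add: compactin_subtopology)
      have "\<exists>U V. openin euclidean U \<and> openin (top_of_set {0..1}) V \<and> r \<in> U \<and> {0..1} \<subseteq> V \<and>
          U \<times> V \<subseteq> (UNIV \<times> {0..1}) \<inter> (\<lambda>p. (fst p - r) *\<^sub>R curve_deriv k a (snd p)) -` W'"
        by (rule tube_lemma_right[OF op co _ sub]) simp
      then obtain U V where U': "openin euclidean U" and rU: "r \<in> U" and V: "{0..1} \<subseteq> V"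
        "U \<times> V \<subseteq> (UNIV \<times> {0..1}) \<inter> (\<lambda>p. (fst p - r) *\<^sub>R curve_deriv k a (snd p)) -` W'"
        by (elim exE conjE) (rule that)
      from U' have U: "open U" by (simp only: open_openin)
      have "(s - r) *\<^sub>R curve_deriv k a t \<in> W" if "s \<in> U" "t \<in> {0..1}" for s t
      proof -
        have "(s, t) \<in> U \<times> V" using V(1) that by (intro SigmaI) (simp, rule subsetD)
        with V(2) have "(s, t) \<in> (UNIV \<times> {0..1}) \<inter> (\<lambda>p. (fst p - r) *\<^sub>R curve_deriv k a (snd p)) -` W'"
          by (rule subsetD)
        then show ?thesis using W'(3) by (simp add: subset_iff)
      qed
      then show ?thesis
        unfolding eventually_nhds by (intro exI[of _ U] conjI U rU ballI)
    qed
    then have "\<forall>\<^sub>F s in nhds r. \<forall>k\<in>{..n}. \<forall>t\<in>{0..1}. (s - r) *\<^sub>R curve_deriv k a t \<in> W"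
      by (intro eventually_ball_finite) auto
    with Q have R: "\<forall>\<^sub>F s in nhds r. Q s \<and> (\<forall>k\<in>{..n}. \<forall>t\<in>{0..1}. (s - r) *\<^sub>R curve_deriv k a t \<in> W)"
      by (rule eventually_conj)
    have "P (s *\<^sub>R c)" if s: "Q s \<and> (\<forall>k\<in>{..n}. \<forall>t\<in>{0..1}. (s - r) *\<^sub>R curve_deriv k a t \<in> W)"
      and c: "c - a \<in> curve_nhd n V'" for s c
    proof (rule V(2))
      have *: "s *\<^sub>R c - r *\<^sub>R a = s *\<^sub>R (c - a) + (s - r) *\<^sub>R a" by (simp add: algebra_simps)
      have "curve_deriv k (s *\<^sub>R (c - a) + (s - r) *\<^sub>R a) t \<in> V" if "k \<le> n" "t \<in> {0..1}" for k t
        unfolding curve_deriv_lincomb[OF that(2)] using that s c QV by (intro W(2)) (auto simp: curve_nhd_def)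
      then show "s *\<^sub>R c - r *\<^sub>R a \<in> curve_nhd n V"
        unfolding * by (simp add: curve_nhd_def)
    qed
    moreover have "\<forall>\<^sub>F c in nhds a. c - a \<in> curve_nhd n V'"
      unfolding eventually_nhds_smooth_curve using V' by (intro exI conjI allI impI)
    ultimately show "\<forall>\<^sub>F p in nhds r \<times>\<^sub>F nhds a. P (fst p *\<^sub>R snd p)"
      unfolding eventually_prod_filter using R by (intro exI conjI allI impI) (assumption | simp)+
  qed
next
  fix c d :: "'a smooth_curve" assume "c \<noteq> d"
  then have "curve_at c \<noteq> curve_at d" by (simp add: curve_at_inject)
  then obtain t where t: "curve_at c t \<noteq> curve_at d t" by auto
  have out: "curve_at e t = 0" if "t \<notin> {0..1}" for e :: "'a smooth_curve"
    using curve_at[of e] that by blast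
  have I: "t \<in> {0..1}"
    using t out[of c] out[of d] by metis
  have op: "open {c. curve_at c t \<in> U}" if "open U" for U :: "'a set"
    unfolding open_subopen[of "{c. curve_at c t \<in> U}"]
  proof
    fix c assume "c \<in> {c. curve_at c t \<in> U}"
    then have "\<forall>\<^sub>F d in nhds c. curve_at d t \<in> U"
      using topological_tendstoD[OF tendsto_curve_at[OF I] that] by simp
    then show "\<exists>T. open T \<and> c \<in> T \<and> T \<subseteq> {c. curve_at c t \<in> U}"
      by (auto simp: eventually_nhds subset_iff)
  qed
  obtain U V where "open U" "open V" "curve_at c t \<in> U" "curve_at d t \<in> V" "U \<inter> V = {}"
    using hausdorff[OF t] by blast
  then show "\<exists>U V. open U \<and> open V \<and> c \<in> U \<and> d \<in> V \<and> U \<inter> V = {}"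
    using op[of U] op[of V]
    by (intro exI[of _ "{c. curve_at c t \<in> U}"] exI[of _ "{c. curve_at c t \<in> V}"]) auto
next
  fix U :: "'a smooth_curve set" assume "\<forall>\<^sub>F c in nhds 0. c \<in> U"
  then obtain n V where V: "eventually (\<lambda>x. x \<in> V) (nhds 0)" "\<And>d. d - 0 \<in> curve_nhd n V \<Longrightarrow> d \<in> U"
    by (rule eventually_nhds_smooth_curveE) (rule that)
  obtain W where W: "convex W" "W \<subseteq> V" "eventually (\<lambda>x. x \<in> W) (nhds 0)"
    using locally_convex'[OF V(1)] by blast
  have "convex (curve_nhd n W)"
    using W(1) unfolding convex_def curve_nhd_def by (simp add: curve_deriv_lincomb)
  moreover have "curve_nhd n W \<subseteq> U"
    using V(2) W(2) by (force simp: curve_nhd_def)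
  moreover have "\<forall>\<^sub>F c in nhds 0. c \<in> curve_nhd n W"
    unfolding eventually_nhds_smooth_curve using W(3) by (intro exI conjI allI impI) simp_all
  ultimately show "\<exists>V. convex V \<and> V \<subseteq> U \<and> (\<forall>\<^sub>F c in nhds 0. c \<in> V)" by blast
qed

section \<open>Manifolds modelled on locally convex spaces\<close>

type_synonym ('m, 'e) chart = "'m set \<times> ('m \<Rightarrow> 'e)"

definition chart_inv :: "('m, 'e) chart \<Rightarrow> 'e \<Rightarrow> 'm" where
  "chart_inv \<kappa> = inv_into (fst \<kappa>) (snd \<kappa>)"

definition is_chart :: "('m::topological_space, 'e::topological_space) chart \<Rightarrow> bool" where
  "is_chart \<kappa> \<longleftrightarrow> open (fst \<kappa>) \<and> open (snd \<kappa> ` fst \<kappa>) \<and>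
     homeomorphism (fst \<kappa>) (snd \<kappa> ` fst \<kappa>) (snd \<kappa>) (chart_inv \<kappa>)"

definition smooth_atlas :: "('m::topological_space, 'e::locally_convex_space) chart set \<Rightarrow> bool" where
  "smooth_atlas A \<longleftrightarrow> (\<forall>\<kappa>\<in>A. is_chart \<kappa>) \<and> (\<Union>\<kappa>\<in>A. fst \<kappa>) = UNIV \<and>
     (\<forall>\<kappa>\<in>A. \<forall>\<kappa>'\<in>A. smooth_on UNIV (snd \<kappa> ` (fst \<kappa> \<inter> fst \<kappa>')) (snd \<kappa>' \<circ> chart_inv \<kappa>))"

definition prod_atlas :: "('m, 'e) chart set \<Rightarrow> ('n, 'f) chart set \<Rightarrow> ('m \<times> 'n, 'e \<times> 'f) chart set" where
  "prod_atlas A B = {(fst \<kappa> \<times> fst \<mu>, map_prod (snd \<kappa>) (snd \<mu>)) | \<kappa> \<mu>. \<kappa> \<in> A \<and> \<mu> \<in> B}"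

definition smooth_map ::
    "('m::topological_space, 'e::locally_convex_space) chart set \<Rightarrow>
     ('n::topological_space, 'f::locally_convex_space) chart set \<Rightarrow> ('m \<Rightarrow> 'n) \<Rightarrow> bool" where
  "smooth_map A B f \<longleftrightarrow> continuous_on UNIV f \<and>
     (\<forall>\<kappa>\<in>A. \<forall>\<mu>\<in>B. smooth_on UNIV (snd \<kappa> ` (fst \<kappa> \<inter> f -` fst \<mu>)) (snd \<mu> \<circ> f \<circ> chart_inv \<kappa>))"

text \<open>
  Smooth maps into a manifold from a subset of a locally convex space; \<open>W\<close> and \<open>S\<close> are as in
  \<^const>\<open>smooth_on\<close>.
\<close>

definition smooth_into ::
    "('m::topological_space, 'e::locally_convex_space) chart set \<Rightarrow>
     'a::locally_convex_space set \<Rightarrow> 'a set \<Rightarrow> ('a \<Rightarrow> 'm) \<Rightarrow> bool" where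
  "smooth_into A W S f \<longleftrightarrow> continuous_on S f \<and>
     (\<forall>\<kappa>\<in>A. smooth_on W (S \<inter> f -` fst \<kappa>) (snd \<kappa> \<circ> f))"

definition charts_at :: "('m, 'e) chart set \<Rightarrow> 'm \<Rightarrow> ('m, 'e) chart set" where
  "charts_at A p = {\<kappa>\<in>A. p \<in> fst \<kappa>}"

text \<open>
  A tangent vector at \<open>p\<close> is the family of its coordinates in the charts at \<open>p\<close>, extended by zero
  to all other charts. The transition maps have continuous linear derivatives, so evaluation at any
  chart at \<open>p\<close> is an isomorphism from the tangent space, with the subspace topology of the
  product topology, onto the model space.
\<close>

type_synonym ('m, 'e) tangent_vector = "('m, 'e) chart \<Rightarrow> 'e"

definition tangent_space ::
    "('m, 'e::locally_convex_space) chart set \<Rightarrow> 'm \<Rightarrow> ('m, 'e) tangent_vector set" where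
  "tangent_space A p = {v.
     (\<forall>\<kappa>. \<kappa> \<notin> charts_at A p \<longrightarrow> v \<kappa> = 0) \<and>
     (\<forall>\<kappa>\<in>charts_at A p. \<forall>\<kappa>'\<in>charts_at A p.
        v \<kappa>' = dir_deriv UNIV (snd \<kappa>' \<circ> chart_inv \<kappa>) (snd \<kappa> p) (v \<kappa>))}"

text \<open>The tangent vector at \<open>p\<close> whose coordinate in the chart \<open>\<kappa>\<close> is \<open>x\<close>.\<close>

definition tangent_of_coord ::
    "('m, 'e::locally_convex_space) chart set \<Rightarrow> ('m, 'e) chart \<Rightarrow> 'm \<Rightarrow> 'e \<Rightarrow> ('m, 'e) tangent_vector" where
  "tangent_of_coord A \<kappa> p x = (\<lambda>\<kappa>'. if \<kappa>' \<in> charts_at A p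
     then dir_deriv UNIV (snd \<kappa>' \<circ> chart_inv \<kappa>) (snd \<kappa> p) x else 0)"

text \<open>The tangent map of \<open>f\<close> at \<open>p\<close>; the result does not depend on the chart \<open>\<kappa>\<close> at \<open>p\<close>.\<close>

definition tangent_map ::
    "('m, 'e::locally_convex_space) chart set \<Rightarrow> ('n, 'f::locally_convex_space) chart set \<Rightarrow>
     ('m \<Rightarrow> 'n) \<Rightarrow> 'm \<Rightarrow> ('m, 'e) tangent_vector \<Rightarrow> ('n, 'f) tangent_vector" where
  "tangent_map A B f p v = (\<lambda>\<mu>. if \<mu> \<in> charts_at B (f p)
     then let \<kappa> = (SOME \<kappa>. \<kappa> \<in> charts_at A p)
          in dir_deriv UNIV (snd \<mu> \<circ> f \<circ> chart_inv \<kappa>) (snd \<kappa> p) (v \<kappa>)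
     else 0)"

definition velocity ::
    "('m, 'e::locally_convex_space) chart set \<Rightarrow> (real \<Rightarrow> 'm) \<Rightarrow> real \<Rightarrow> ('m, 'e) tangent_vector" where
  "velocity A \<gamma> t = (\<lambda>\<kappa>. if \<kappa> \<in> charts_at A (\<gamma> t) then dir_deriv {0..1} (snd \<kappa> \<circ> \<gamma>) t 1 else 0)"

text \<open>The coordinate form of \<open>[X, Y]\<close> is \<open>dY(X) - dX(Y)\<close>.\<close>

definition vf_bracket ::
    "('m, 'e::locally_convex_space) chart set \<Rightarrow> ('m \<Rightarrow> ('m, 'e) tangent_vector) \<Rightarrow>
     ('m \<Rightarrow> ('m, 'e) tangent_vector) \<Rightarrow> 'm \<Rightarrow> ('m, 'e) tangent_vector" where
  "vf_bracket A X Y p = (\<lambda>\<kappa>. if \<kappa> \<in> charts_at A p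
     then dir_deriv UNIV (\<lambda>x. Y (chart_inv \<kappa> x) \<kappa>) (snd \<kappa> p) (X p \<kappa>) -
          dir_deriv UNIV (\<lambda>x. X (chart_inv \<kappa> x) \<kappa>) (snd \<kappa> p) (Y p \<kappa>)
     else 0)"

text \<open>
  Smooth real-valued 2-forms. Values of \<open>\<eta> p\<close> outside the tangent space at \<open>p\<close> are irrelevant.
  Linearity in the second argument follows from skew-symmetry.
\<close>

definition differential_2form ::
    "('m::topological_space, 'e::locally_convex_space) chart set \<Rightarrow>
     ('m \<Rightarrow> ('m, 'e) tangent_vector \<Rightarrow> ('m, 'e) tangent_vector \<Rightarrow> real) \<Rightarrow> bool" where
  "differential_2form A \<eta> \<longleftrightarrow>
     (\<forall>p. \<forall>u\<in>tangent_space A p. \<forall>v\<in>tangent_space A p. \<forall>w\<in>tangent_space A p. \<forall>a b.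
        \<eta> p (a *\<^sub>R u + b *\<^sub>R v) w = a * \<eta> p u w + b * \<eta> p v w) \<and>
     (\<forall>p. \<forall>v\<in>tangent_space A p. \<forall>w\<in>tangent_space A p. \<eta> p v w = - \<eta> p w v) \<and>
     (\<forall>\<kappa>\<in>A. smooth_on UNIV ((snd \<kappa> ` fst \<kappa>) \<times> (UNIV :: ('e \<times> 'e) set))
        (\<lambda>(x, v, w). let p = chart_inv \<kappa> x
           in \<eta> p (tangent_of_coord A \<kappa> p v) (tangent_of_coord A \<kappa> p w)))"


section \<open>Lie groups\<close>

record ('g, 'e) lie_data =
  gmult :: "'g \<Rightarrow> 'g \<Rightarrow> 'g"
  gone :: 'g
  ginv :: "'g \<Rightarrow> 'g"
  gatlas :: "('g, 'e) chart set"

definition lie_group :: "('g::t2_space, 'e::locally_convex_space) lie_data \<Rightarrow> bool" where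
  "lie_group G \<longleftrightarrow> group (gmult G) (gone G) (ginv G) \<and> smooth_atlas (gatlas G) \<and>
     smooth_map (prod_atlas (gatlas G) (gatlas G)) (gatlas G) (\<lambda>(x, y). gmult G x y) \<and>
     smooth_map (gatlas G) (gatlas G) (ginv G)"

definition lie_algebra ::
    "('g, 'e::locally_convex_space) lie_data \<Rightarrow> ('g, 'e) tangent_vector set" where
  "lie_algebra G = tangent_space (gatlas G) (gone G)"

definition left_invariant_field ::
    "('g, 'e::locally_convex_space) lie_data \<Rightarrow> ('g, 'e) tangent_vector \<Rightarrow> 'g \<Rightarrow> ('g, 'e) tangent_vector" where
  "left_invariant_field G v g = tangent_map (gatlas G) (gatlas G) (gmult G g) (gone G) v"

definition lie_bracket ::
    "('g, 'e::locally_convex_space) lie_data \<Rightarrow> ('g, 'e) tangent_vector \<Rightarrow>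
     ('g, 'e) tangent_vector \<Rightarrow> ('g, 'e) tangent_vector" where
  "lie_bracket G v w =
     vf_bracket (gatlas G) (left_invariant_field G v) (left_invariant_field G w) (gone G)"

definition topologically_perfect :: "('g, 'e::locally_convex_space) lie_data \<Rightarrow> bool" where
  "topologically_perfect G \<longleftrightarrow>
     top_of_set (lie_algebra G) closure_of
       span {lie_bracket G v w | v w. v \<in> lie_algebra G \<and> w \<in> lie_algebra G} = lie_algebra G"

definition left_log_deriv ::
    "('g, 'e::locally_convex_space) lie_data \<Rightarrow> (real \<Rightarrow> 'g) \<Rightarrow> real \<Rightarrow> ('g, 'e) tangent_vector" where
  "left_log_deriv G \<gamma> t =
     tangent_map (gatlas G) (gatlas G) (gmult G (ginv G (\<gamma> t))) (\<gamma> t) (velocity (gatlas G) \<gamma> t)"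

text \<open>
  The space of smooth curves \<open>[0,1] \<rightarrow> T\<^sub>eG\<close>, as a subspace of the smooth curves in the ambient
  product space.
\<close>

definition lie_algebra_curves ::
    "('g, 'e::locally_convex_space) lie_data \<Rightarrow> ('g, 'e) tangent_vector smooth_curve set" where
  "lie_algebra_curves G = {c. \<forall>t\<in>{0..1}. curve_at c t \<in> lie_algebra G}"

definition is_evolution ::
    "('g::topological_space, 'e::locally_convex_space) lie_data \<Rightarrow>
     ('g, 'e) tangent_vector smooth_curve \<Rightarrow> (real \<Rightarrow> 'g) \<Rightarrow> bool" where
  "is_evolution G c \<gamma> \<longleftrightarrow> smooth_into (gatlas G) UNIV {0..1} \<gamma> \<and> \<gamma> 0 = gone G \<and>
     (\<forall>t\<in>{0..1}. left_log_deriv G \<gamma> t = curve_at c t)"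

text \<open>
  Since \<^const>\<open>is_evolution\<close> determines \<open>\<gamma>\<close> on \<open>[0,1]\<close>, the choice of \<open>Evol\<close> does not affect
  the map \<open>c \<mapsto> Evol c 1\<close>.
\<close>

definition milnor_regular :: "('g::topological_space, 'e::locally_convex_space) lie_data \<Rightarrow> bool" where
  "milnor_regular G \<longleftrightarrow> (\<exists>Evol.
     (\<forall>c\<in>lie_algebra_curves G. is_evolution G c (Evol c)) \<and>
     smooth_into (gatlas G) (lie_algebra_curves G) (lie_algebra_curves G) (\<lambda>c. Evol c 1))"

definition bi_invariant ::
    "('g, 'e::locally_convex_space) lie_data \<Rightarrow>
     ('g \<Rightarrow> ('g, 'e) tangent_vector \<Rightarrow> ('g, 'e) tangent_vector \<Rightarrow> real) \<Rightarrow> bool" where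
  "bi_invariant G \<eta> \<longleftrightarrow> (\<forall>g p. \<forall>v\<in>tangent_space (gatlas G) p. \<forall>w\<in>tangent_space (gatlas G) p.
     (let L = (\<lambda>x. gmult G g x); R = (\<lambda>x. gmult G x g); T = tangent_map (gatlas G) (gatlas G)
      in \<eta> (L p) (T L p v) (T L p w) = \<eta> p v w \<and> \<eta> (R p) (T R p v) (T R p w) = \<eta> p v w))"

end

theory Submission
  imports Defs
begin

text \<open>
  Evaluating a bi-invariant 2-form at the unit gives a continuous skew form \<open>\<omega>\<close> on the Lie
  algebra which is invariant under the adjoint action. Differentiating this invariance yields
  \<open>\<omega>([x,y],z) + \<omega>(y,[x,z]) = 0\<close>. Hence \<open>\<omega>([x,y],z)\<close> is skew in \<open>x,y\<close> and, because \<open>\<omega>\<close> is skew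
  as well, symmetric in \<open>y,z\<close>. A trilinear map with both symmetries is zero
  (\<open>invariant_skew_form_vanishes_on_brackets\<close>): moving the letters around a full circle by these
  transpositions changes the sign. So \<open>\<omega>\<close> annihilates all brackets, by continuity the closure of
  their span, which is the whole Lie algebra, and left translation carries \<open>\<omega> = 0\<close> to every
  point of the group.

  The adjoint action itself never appears. In a chart at the unit, with \<open>m(x,y)\<close> for the product,
  left invariance says that \<open>\<Omega>(a; \<partial>\<^sub>2m(a,e)v, \<partial>\<^sub>2m(a,e)w)\<close> is constant in \<open>a\<close>, and right invariance
  that \<open>\<Omega>(a; \<partial>\<^sub>1m(e,a)v, \<partial>\<^sub>1m(e,a)w)\<close> is the same constant, where \<open>\<Omega>\<close> is the form in coordinates.
  Subtracting the two and dividing by \<open>t\<close> along \<open>a = e + t u\<close>, the variation of \<open>\<Omega>\<close> in the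
  base point drops out, so that continuity and bilinearity of \<open>\<Omega>\<close> suffice to pass to the limit
  (\<open>bilinear_invariance_derivative\<close>). With \<open>B(u,v) = \<partial>\<^sub>1\<partial>\<^sub>2m(e,e)(u,v)\<close>, the left-hand terms
  contribute \<open>B(u,v)\<close>, and the right-hand ones \<open>B(v,u)\<close> by the symmetry of second derivatives
  (\<open>second_deriv_symmetric\<close>); the difference is the coordinate expression of \<open>[u,v]\<close>
  (\<open>lie_bracket_coord\<close>).

  The calculus behind this (strict differentiability, linearity of the derivative, the chain rule,
  the symmetry of second derivatives) rests on a mean value theorem with values in a convex set,
  which replaces norm estimates and the Hahn-Banach theorem.
\<close>

section \<open>The mean value theorem in locally convex spaces\<close>

lemma convex_neighbourhood:
  fixes p :: "'a::locally_convex_space"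
  assumes "open U" "p \<in> U"
  obtains C where "convex C" "C \<subseteq> U" "p \<in> interior C"
proof -
  have lim: "((\<lambda>x. p + x) \<longlongrightarrow> p + 0) (nhds 0)"
    by (intro tendsto_intros filterlim_ident)
  have "eventually (\<lambda>x. x \<in> {x. p + x \<in> U}) (nhds 0)"
    using topological_tendstoD[OF lim assms(1)] assms(2) by simp
  from locally_convex'[OF this] obtain V where V: "convex V" "V \<subseteq> {x. p + x \<in> U}"
    "eventually (\<lambda>x. x \<in> V) (nhds 0)" by blast
  define C where "C = (\<lambda>x. p + x) ` V"
  have "convex C" unfolding C_def using V(1) by (rule convex_translation)
  moreover have "C \<subseteq> U" using V(2) by (auto simp: C_def)
  moreover have "p \<in> interior C"
  proof -
    have "((\<lambda>y. y - p) \<longlongrightarrow> p - p) (nhds p)"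
      by (intro tendsto_intros filterlim_ident)
    then have "eventually (\<lambda>y. y - p \<in> V) (nhds p)"
      using eventually_compose_filterlim[OF V(3)] by simp
    moreover have "y \<in> C" if "y - p \<in> V" for y
      unfolding C_def using that by (intro image_eqI[of _ _ "y - p"]) simp_all
    ultimately have "eventually (\<lambda>y. y \<in> C) (nhds p)"
      by (auto elim: eventually_mono)
    then show ?thesis
      by (auto simp: eventually_nhds interior_def)
  qed
  ultimately show ?thesis by (rule that)
qed

text \<open>
  The slope over an interval is a convex combination of the slopes over the two parts into which
  a point divides it. So slopes in \<open>C\<close> propagate from adjacent intervals to their union, and
  a Bolzano bisection reduces the claim to small intervals around a point \<open>t\<close>, where the slopes to
  \<open>t\<close> from either side are close to \<open>f' t\<close>. The interior is needed for that last step.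
\<close>

lemma mean_value_convex:
  fixes f :: "real \<Rightarrow> 'a::locally_convex_space"
  assumes C: "convex C" and ab: "a < b"
    and lim: "\<And>t. a \<le> t \<Longrightarrow> t \<le> b \<Longrightarrow> ((\<lambda>y. (f y - f t) /\<^sub>R (y - t)) \<longlongrightarrow> f' t) (at t)"
    and f': "\<And>t. a \<le> t \<Longrightarrow> t \<le> b \<Longrightarrow> f' t \<in> interior C"
  shows "(f b - f a) /\<^sub>R (b - a) \<in> C"
proof -
  define Q where "Q a b = (f b - f a) /\<^sub>R (b - a)" for a b
  have comb: "Q a c \<in> C" if "a < b" "b < c" "Q a b \<in> C" "Q b c \<in> C" for a b c
  proof -
    have "((b - a) / (c - a)) *\<^sub>R Q a b + ((c - b) / (c - a)) *\<^sub>R Q b c = Q a c"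
    proof -
      have "((b - a) / (c - a)) *\<^sub>R Q a b = (f b - f a) /\<^sub>R (c - a)"
        "((c - b) / (c - a)) *\<^sub>R Q b c = (f c - f b) /\<^sub>R (c - a)"
        using that by (simp_all add: Q_def divide_inverse)
      then show ?thesis by (simp add: Q_def scaleR_add_right[symmetric] del: scaleR_scaleR)
    qed
    moreover have "((b - a) / (c - a)) *\<^sub>R Q a b + ((c - b) / (c - a)) *\<^sub>R Q b c \<in> C"
      using that by (intro convexD[OF C]) (simp_all add: diff_divide_distrib[symmetric] add_divide_distrib[symmetric])
    ultimately show ?thesis by simp
  qed
  have "a \<le> b" using ab by simp
  then have "a < b \<longrightarrow> Q a b \<in> C"
  proof (induction rule: Bolzano)
    case (trans a b c)
    then show ?case using comb[of a b c] by (cases "a = b"; cases "b = c") auto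
  next
    case (local t)
    then have "eventually (\<lambda>y. (f y - f t) /\<^sub>R (y - t) \<in> interior C) (at t)"
      using topological_tendstoD[OF lim _ f'] by auto
    then obtain d where d: "d > 0" "\<And>y. y \<noteq> t \<Longrightarrow> dist y t < d \<Longrightarrow> (f y - f t) /\<^sub>R (y - t) \<in> interior C"
      unfolding eventually_at by auto
    have "Q x y \<in> C" if "x \<le> t" "t \<le> y" "y - x < d" "x < y" for x y
    proof -
      have "inverse (t - x) = - inverse (x - t)" by (simp flip: inverse_minus_eq)
      then have sym: "Q x t = (f x - f t) /\<^sub>R (x - t)" by (simp add: Q_def scaleR_diff_right)
      have "Q x t \<in> C" if "x < t"
        using d(2)[of x] interior_subset[of C] \<open>y - x < d\<close> \<open>t \<le> y\<close> that
        unfolding sym by (auto simp: dist_real_def)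
      moreover have "Q t y \<in> C" if "t < y"
        using d(2)[of y] interior_subset[of C] \<open>y - x < d\<close> \<open>x \<le> t\<close> that
        unfolding Q_def by (auto simp: dist_real_def)
      moreover have "x < t \<or> x = t" "t < y \<or> t = y" using that by auto
      ultimately show ?thesis
        using comb[of x t y] \<open>x < y\<close> by (elim disjE) simp_all
    qed
    then show ?case using d(1) by (intro exI[of _ d]) auto
  qed
  then show ?thesis using ab by (simp add: Q_def)
qed

text \<open>
  Both signs of \<open>t\<close> are covered, since directional derivatives are two-sided limits.
\<close>

lemma dir_mean_value_convex:
  fixes f :: "'a::real_vector \<Rightarrow> 'b::locally_convex_space"
  assumes C: "convex C" and t: "t \<noteq> 0"
    and lim: "\<And>r. \<bar>r\<bar> \<le> \<bar>t\<bar> \<Longrightarrow> (dir_quotient f (x + r *\<^sub>R w) w \<longlongrightarrow> d r) (at 0)"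
    and d: "\<And>r. \<bar>r\<bar> \<le> \<bar>t\<bar> \<Longrightarrow> d r \<in> interior C"
  shows "dir_quotient f x w t \<in> C"
proof -
  define g where "g r = f (x + r *\<^sub>R w)" for r
  have "((\<lambda>y. (g y - g r) /\<^sub>R (y - r)) \<longlongrightarrow> d r) (at r)" if "\<bar>r\<bar> \<le> \<bar>t\<bar>" for r
  proof -
    have "(\<lambda>h. (g (r + h) - g r) /\<^sub>R (r + h - r)) = dir_quotient f (x + r *\<^sub>R w) w"
      by (simp add: fun_eq_iff g_def dir_quotient_def algebra_simps)
    then show ?thesis
      using lim[OF that] unfolding filterlim_at_to_0[of _ _ r] by (simp add: add.commute)
  qed
  note mv = mean_value_convex[OF C _ this d]
  show ?thesis
  proof (cases "t > 0")
    case True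
    then show ?thesis using mv[of 0 t] by (simp add: g_def dir_quotient_def)
  next
    case False
    then have "(g 0 - g t) /\<^sub>R (0 - t) \<in> C" using mv[of t 0] t by simp
    moreover have "(g 0 - g t) /\<^sub>R (0 - t) = dir_quotient f x w t"
      by (simp add: g_def dir_quotient_def scaleR_diff_right)
    ultimately show ?thesis by simp
  qed
qed

section \<open>Directional derivatives at interior points\<close>

lemma tendsto_line:
  fixes x :: "'a::locally_convex_space"
  shows "((\<lambda>t. x + t *\<^sub>R v) \<longlongrightarrow> x) (nhds 0)"
proof -
  have "((\<lambda>t. x + t *\<^sub>R v) \<longlongrightarrow> x + 0 *\<^sub>R v) (nhds 0)"
    by (intro tendsto_intros tendsto_scaleR_lcs filterlim_ident)
  then show ?thesis by simp
qed

lemma eventually_line_mem: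
  fixes x :: "'a::locally_convex_space"
  assumes "open S" "x \<in> S"
  shows "eventually (\<lambda>t. x + t *\<^sub>R v \<in> S) (nhds 0)"
  using topological_tendstoD[OF tendsto_line assms] .

lemma dir_filter_open:
  fixes x :: "'a::locally_convex_space"
  assumes "open S" "x \<in> S"
  shows "dir_filter S x v = at 0"
proof -
  obtain T where T: "open T" "0 \<in> T" "\<And>t. t \<in> T \<Longrightarrow> x + t *\<^sub>R v \<in> S"
    using eventually_line_mem[OF assms, of v] unfolding eventually_nhds by auto
  show ?thesis unfolding dir_filter_def
    by (rule at_within_nhd[of _ T]) (use T in auto)
qed

lemma dir_quotient_cong_ev:
  fixes x :: "'a::locally_convex_space"
  assumes "open S" "x \<in> S" "\<And>y. y \<in> S \<Longrightarrow> f y = g y"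
  shows "eventually (\<lambda>t. dir_quotient f x v t = dir_quotient g x v t) (at 0)"
proof -
  have "eventually (\<lambda>t. x + t *\<^sub>R v \<in> S) (at 0)"
    using eventually_line_mem[OF assms(1,2), of v] by (auto simp: eventually_at_filter elim: eventually_mono)
  then show ?thesis by eventually_elim (simp add: dir_quotient_def assms)
qed

lemma dir_quotient_tendsto_cong:
  fixes x :: "'a::locally_convex_space"
  assumes "open S" "x \<in> S" "\<And>y. y \<in> S \<Longrightarrow> f y = g y"
  shows "(dir_quotient f x v \<longlongrightarrow> l) (at 0) \<longleftrightarrow> (dir_quotient g x v \<longlongrightarrow> l) (at 0)"
  by (rule tendsto_cong[OF dir_quotient_cong_ev[OF assms]])

lemma dir_deriv_cong_open:
  fixes x :: "'a::locally_convex_space"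
  assumes "open S" "x \<in> S" "\<And>y. y \<in> S \<Longrightarrow> f y = g y"
  shows "dir_deriv UNIV f x v = dir_deriv UNIV g x v"
  using dir_quotient_tendsto_cong[OF assms]
  by (simp add: dir_deriv_def Topological_Spaces.Lim_def dir_filter_def)

lemma dir_deriv_eqI:
  fixes x :: "'a::real_vector"
  assumes "(dir_quotient f x v \<longlongrightarrow> l) (at 0)"
  shows "dir_deriv UNIV f x v = l"
  using tendsto_Lim[OF _ assms] by (simp add: dir_deriv_def dir_filter_def)

lemma dir_deriv_open:
  fixes x :: "'a::locally_convex_space"
  assumes "open S" "x \<in> S"
  shows "dir_deriv S f x v = dir_deriv UNIV f x v"
  by (simp add: dir_deriv_def dir_filter_open[OF assms] dir_filter_open[OF open_UNIV])

section \<open>Continuously differentiable maps\<close>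

text \<open>
  Derivatives are computed with \<open>UNIV\<close> as domain even if \<open>f\<close> is only meaningful on \<open>S\<close>, so that
  restricting \<open>S\<close> does not change the derivative.
\<close>

definition C1_on :: "'a::locally_convex_space set \<Rightarrow> ('a \<Rightarrow> 'b::locally_convex_space) \<Rightarrow> bool" where
  "C1_on S f \<longleftrightarrow> open S \<and>
     (\<forall>x\<in>S. \<forall>v. (dir_quotient f x v \<longlongrightarrow> dir_deriv UNIV f x v) (at 0)) \<and>
     continuous_on (S \<times> UNIV) (\<lambda>(x, v). dir_deriv UNIV f x v)"

lemma C1_onD: "C1_on S f \<Longrightarrow> x \<in> S \<Longrightarrow> (dir_quotient f x v \<longlongrightarrow> dir_deriv UNIV f x v) (at 0)"
  by (simp add: C1_on_def)

lemma continuous_on_const_sequence: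
  "continuous_on S (\<lambda>p. (fst p, \<lambda>_::nat. snd p))"
  unfolding continuous_on_def
  by (auto intro!: tendsto_Pair tendsto_coordinatewise tendsto_fst tendsto_snd)

text \<open>
  The first derivative depends on the sequence of directions only through its entry \<open>0\<close>, so a single
  direction is fed in as a constant sequence.
\<close>

lemma smooth_on_imp_C1_on:
  assumes "smooth_on UNIV S f" "open S"
  shows "C1_on S f"
proof -
  have lim: "(dir_quotient f x v \<longlongrightarrow> dir_deriv UNIV f x v) (at 0)" if x: "x \<in> S" for x v
  proof -
    obtain l where "(dir_quotient f x v \<longlongrightarrow> l) (at 0)"
      using assms(1)[unfolded smooth_on_def, THEN spec[of _ 0]] x dir_filter_open[OF assms(2) x]
      by (force dest: bspec[of _ _ "\<lambda>_. v"])
    then show ?thesis using dir_deriv_eqI by metis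
  qed
  have "continuous_on (S \<times> (UNIV \<rightarrow> UNIV)) (\<lambda>(x, v). iter_dir_deriv S f (Suc 0) x v)"
    using assms(1) unfolding smooth_on_def by blast
  then have "continuous_on (S \<times> UNIV) (\<lambda>p. (\<lambda>(x, v). iter_dir_deriv S f (Suc 0) x v) (fst p, \<lambda>_. snd p))"
    by (rule continuous_on_compose2[OF _ continuous_on_const_sequence]) auto
  then have "continuous_on (S \<times> UNIV) (\<lambda>(x, v). dir_deriv UNIV f x v)"
    by (rule continuous_on_eq) (auto simp: dir_deriv_open[OF assms(2)])
  with lim assms(2) show ?thesis by (simp add: C1_on_def)
qed

lemma C1_on_subset_cong:
  assumes f: "C1_on S f" and T: "open T" "T \<subseteq> S" "\<And>x. x \<in> T \<Longrightarrow> f x = g x"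
  shows "C1_on T g"
  unfolding C1_on_def
proof (intro conjI ballI allI)
  have D: "dir_deriv UNIV f x v = dir_deriv UNIV g x v" if "x \<in> T" for x v
    by (rule dir_deriv_cong_open[OF T(1) that T(3)])
  show "(dir_quotient g x v \<longlongrightarrow> dir_deriv UNIV g x v) (at 0)" if "x \<in> T" for x v
    using C1_onD[OF f, of x v] that T dir_quotient_tendsto_cong[OF T(1) that T(3)] D[OF that, of v] by auto
  have "continuous_on (T \<times> UNIV) (\<lambda>(x, v). dir_deriv UNIV f x v)"
    using f T(2) by (auto simp: C1_on_def elim!: continuous_on_subset)
  then show "continuous_on (T \<times> UNIV) (\<lambda>(x, v). dir_deriv UNIV g x v)"
    by (rule continuous_on_eq) (auto simp: D)
qed (rule T(1))

lemma C1_on_compose_affine: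
  fixes j :: "'a::locally_convex_space \<Rightarrow> 'b::locally_convex_space"
  assumes f: "C1_on S f" and i: "continuous_on UNIV i" and j: "continuous_on UNIV j"
    and aff: "\<And>x v t. i (x + t *\<^sub>R v) = i x + t *\<^sub>R j v"
  shows "C1_on (i -` S) (\<lambda>x. f (i x))"
proof -
  have q: "dir_quotient (\<lambda>x. f (i x)) x v = dir_quotient f (i x) (j v)" for x v
    by (simp add: fun_eq_iff dir_quotient_def aff)
  then have D: "dir_deriv UNIV (\<lambda>x. f (i x)) x v = dir_deriv UNIV f (i x) (j v)" for x v
    by (simp add: dir_deriv_def dir_filter_def)
  have "open (i -` S)" using i f by (simp add: C1_on_def open_vimage)
  moreover have "continuous_on ((i -` S) \<times> UNIV) (\<lambda>p. (\<lambda>(x, v). dir_deriv UNIV f x v) (i (fst p), j (snd p)))"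
  proof (rule continuous_on_compose2[of "S \<times> UNIV"])
    show "continuous_on (S \<times> UNIV) (\<lambda>(x, v). dir_deriv UNIV f x v)" using f by (simp add: C1_on_def)
    show "continuous_on ((i -` S) \<times> UNIV) (\<lambda>p. (i (fst p), j (snd p)))"
      by (intro continuous_on_Pair continuous_on_compose2[OF i] continuous_on_compose2[OF j] continuous_intros) auto
  qed auto
  ultimately show ?thesis using f unfolding C1_on_def q D by (auto simp: case_prod_unfold)
qed

text \<open>
  Strict differentiability: base point and direction may vary together with \<open>t\<close>. Additivity
  of the derivative uses a moving base point, the chain rule a moving direction.
\<close>

lemma C1_on_strict:
  fixes x :: "'a::locally_convex_space" and f :: "'a \<Rightarrow> 'b::locally_convex_space"
  assumes f: "C1_on S f" and x: "x \<in> S"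
  shows "((\<lambda>(y, v, t). dir_quotient f y v t) \<longlongrightarrow> dir_deriv UNIV f x w)
    (nhds x \<times>\<^sub>F (nhds w \<times>\<^sub>F at 0))"
proof (rule topological_tendstoI)
  fix U assume "open U" "dir_deriv UNIV f x w \<in> U"
  then obtain C where C: "convex C" "C \<subseteq> U" "dir_deriv UNIV f x w \<in> interior C"
    by (rule convex_neighbourhood)
  have S: "open S" using f by (simp add: C1_on_def)
  have "\<forall>\<^sub>F p in nhds (x, w). p \<in> S \<times> UNIV \<and> (\<lambda>(y, v). dir_deriv UNIV f y v) p \<in> interior C"
  proof -
    have "open (S \<times> (UNIV :: 'a set))" using S by (simp add: open_Times)
    moreover have "continuous_on (S \<times> UNIV) (\<lambda>(y, v). dir_deriv UNIV f y v)"
      using f by (simp add: C1_on_def)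
    ultimately have "open ((S \<times> UNIV) \<inter> (\<lambda>(y, v). dir_deriv UNIV f y v) -` interior C)"
      by (simp add: continuous_open_preimage del: Times_Int_Times)
    then show ?thesis
      unfolding eventually_nhds using C(3) x
      by (intro exI[of _ "(S \<times> UNIV) \<inter> (\<lambda>(y, v). dir_deriv UNIV f y v) -` interior C"]) auto
  qed
  moreover have "((\<lambda>q. (fst q + snd (snd q) *\<^sub>R fst (snd q), fst (snd q))) \<longlongrightarrow> (x + 0 *\<^sub>R w, w)) (nhds (x, w, 0))"
    using tendsto_fst[OF tendsto_snd_nhds[of "(w, 0::real)" x]] tendsto_snd[OF tendsto_snd_nhds[of "(w, 0::real)" x]]
    by (intro tendsto_Pair tendsto_add tendsto_scaleR_lcs tendsto_fst_nhds) simp_all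
  ultimately have "\<forall>\<^sub>F q in nhds (x, w, 0::real). fst q + snd (snd q) *\<^sub>R fst (snd q) \<in> S \<and>
      dir_deriv UNIV f (fst q + snd (snd q) *\<^sub>R fst (snd q)) (fst (snd q)) \<in> interior C"
    using eventually_compose_filterlim by fastforce
  then obtain P Q R where P: "eventually P (nhds x)" and Q: "eventually Q (nhds w)"
    and R: "eventually R (nhds (0::real))"
    and PQR: "\<And>y v r. P y \<Longrightarrow> Q v \<Longrightarrow> R r \<Longrightarrow> y + r *\<^sub>R v \<in> S \<and> dir_deriv UNIV f (y + r *\<^sub>R v) v \<in> interior C"
    unfolding nhds_prod eventually_prod_filter by (auto simp: eventually_prod_filter)
  obtain d where d: "d > 0" "\<And>r. \<bar>r\<bar> < d \<Longrightarrow> R r"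
    using R unfolding eventually_nhds_metric by (auto simp: dist_real_def)
  have "dir_quotient f y v t \<in> U" if "P y" "Q v" "t \<noteq> 0 \<and> \<bar>t\<bar> < d" for y v t
  proof -
    have "dir_quotient f y v t \<in> C"
      using that PQR d(2) by (intro dir_mean_value_convex[OF C(1), where d = "\<lambda>r. dir_deriv UNIV f (y + r *\<^sub>R v) v"]
          C1_onD[OF f]) auto
    then show ?thesis using C(2) by auto
  qed
  moreover have "eventually (\<lambda>t. t \<noteq> 0 \<and> \<bar>t\<bar> < d) (at 0)"
    unfolding eventually_at using d(1) by (intro exI[of _ d]) (auto simp: dist_real_def)
  then have "eventually (\<lambda>(v, t). Q v \<and> (t \<noteq> 0 \<and> \<bar>t\<bar> < d)) (nhds w \<times>\<^sub>F at 0)"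
    using Q unfolding eventually_prod_filter
    by (intro exI[of _ Q] exI[of _ "\<lambda>t. t \<noteq> 0 \<and> \<bar>t\<bar> < d"]) auto
  ultimately show "\<forall>\<^sub>F q in nhds x \<times>\<^sub>F (nhds w \<times>\<^sub>F at 0). (case q of (y, v, t) \<Rightarrow> dir_quotient f y v t) \<in> U"
    using P unfolding eventually_prod_filter[of _ "nhds x"]
    by (intro exI[of _ P] exI[of _ "\<lambda>(v, t). Q v \<and> (t \<noteq> 0 \<and> \<bar>t\<bar> < d)"]) auto
qed

lemma C1_on_strict_tendsto:
  fixes x :: "'a::locally_convex_space" and f :: "'a \<Rightarrow> 'b::locally_convex_space"
  assumes "C1_on S f" "x \<in> S" "(y \<longlongrightarrow> x) (at 0)" "(v \<longlongrightarrow> w) (at 0)"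
  shows "((\<lambda>t. dir_quotient f (y t) (v t) t) \<longlongrightarrow> dir_deriv UNIV f x w) (at 0)"
proof -
  have "filterlim (\<lambda>t. (y t, v t, t)) (nhds x \<times>\<^sub>F (nhds w \<times>\<^sub>F at 0)) (at 0)"
    using assms(3,4) by (intro filterlim_Pair filterlim_ident)
  from filterlim_compose[OF C1_on_strict[OF assms(1,2)] this] show ?thesis by simp
qed

lemma tendsto_line_at:
  fixes x :: "'a::locally_convex_space"
  shows "((\<lambda>t. x + t *\<^sub>R v) \<longlongrightarrow> x) (at 0)"
  by (rule tendsto_mono[OF at_within_le_nhds tendsto_line])

lemma dir_deriv_add:
  assumes f: "C1_on S f" and x: "x \<in> S"
  shows "dir_deriv UNIV f x (v + w) = dir_deriv UNIV f x v + dir_deriv UNIV f x w"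
proof (rule dir_deriv_eqI)
  have "((\<lambda>t. dir_quotient f x v t + dir_quotient f (x + t *\<^sub>R v) w t) \<longlongrightarrow>
      dir_deriv UNIV f x v + dir_deriv UNIV f x w) (at 0)"
    by (intro tendsto_add C1_onD[OF f x] C1_on_strict_tendsto[OF f x] tendsto_line_at tendsto_const)
  moreover have "(\<lambda>t. dir_quotient f x v t + dir_quotient f (x + t *\<^sub>R v) w t) = dir_quotient f x (v + w)"
    by (simp add: fun_eq_iff dir_quotient_def algebra_simps)
  ultimately show "(dir_quotient f x (v + w) \<longlongrightarrow> dir_deriv UNIV f x v + dir_deriv UNIV f x w) (at 0)"
    by simp
qed

lemma dir_deriv_scaleR:
  assumes f: "C1_on S f" and x: "x \<in> S"
  shows "dir_deriv UNIV f x (c *\<^sub>R v) = c *\<^sub>R dir_deriv UNIV f x v"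
proof (cases "c = 0")
  case True
  show ?thesis by (rule dir_deriv_eqI) (simp add: True dir_quotient_def[abs_def])
next
  case False
  show ?thesis
  proof (rule dir_deriv_eqI)
    have "filterlim (\<lambda>t. t * c) (at (0 * c)) (at 0)"
      using False by (intro filterlim_atI tendsto_intros) (auto simp: eventually_at_filter)
    then have "((\<lambda>t. dir_quotient f x v (t * c)) \<longlongrightarrow> dir_deriv UNIV f x v) (at 0)"
      using filterlim_compose[OF C1_onD[OF f x, of v]] by simp
    then have "((\<lambda>t. c *\<^sub>R dir_quotient f x v (t * c)) \<longlongrightarrow> c *\<^sub>R dir_deriv UNIV f x v) (at 0)"
      by (intro tendsto_scaleR_lcs tendsto_const)
    moreover have "(\<lambda>t. c *\<^sub>R dir_quotient f x v (t * c)) = dir_quotient f x (c *\<^sub>R v)"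
      using False by (simp add: fun_eq_iff dir_quotient_def)
    ultimately show "(dir_quotient f x (c *\<^sub>R v) \<longlongrightarrow> c *\<^sub>R dir_deriv UNIV f x v) (at 0)"
      by simp
  qed
qed

lemma dir_deriv_chain:
  assumes lim: "(dir_quotient f x v \<longlongrightarrow> dir_deriv UNIV f x v) (at 0)"
    and g: "C1_on T g" "f x \<in> T"
  shows "dir_deriv UNIV (\<lambda>y. g (f y)) x v = dir_deriv UNIV g (f x) (dir_deriv UNIV f x v)"
proof (rule dir_deriv_eqI)
  have "((\<lambda>t. dir_quotient g (f x) (dir_quotient f x v t) t) \<longlongrightarrow>
      dir_deriv UNIV g (f x) (dir_deriv UNIV f x v)) (at 0)"
    by (intro C1_on_strict_tendsto[OF g] tendsto_const lim)
  moreover have "\<forall>\<^sub>F t in at 0. dir_quotient g (f x) (dir_quotient f x v t) t = dir_quotient (\<lambda>y. g (f y)) x v t"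
    unfolding eventually_at_filter by (auto simp: dir_quotient_def)
  ultimately show "(dir_quotient (\<lambda>y. g (f y)) x v \<longlongrightarrow> dir_deriv UNIV g (f x) (dir_deriv UNIV f x v)) (at 0)"
    by (simp add: tendsto_cong)
qed

lemma dir_deriv_id: "dir_deriv UNIV (\<lambda>y. y) x v = v"
proof (rule dir_deriv_eqI)
  have "\<forall>\<^sub>F t in at 0. dir_quotient (\<lambda>y. y) x v t = v"
    unfolding eventually_at_filter by (auto simp: dir_quotient_def)
  then show "(dir_quotient (\<lambda>y. y) x v \<longlongrightarrow> v) (at 0)" by (rule tendsto_eventually)
qed

lemma smooth_on_second_deriv:
  assumes f: "smooth_on UNIV S f" and S: "open S"
  shows smooth_on_second_deriv_tendsto: "x \<in> S \<Longrightarrow> (dir_quotient (\<lambda>y. dir_deriv UNIV f y v) x w \<longlongrightarrow>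
      dir_deriv UNIV (\<lambda>y. dir_deriv UNIV f y v) x w) (at 0)"
    and smooth_on_second_deriv_continuous:
      "continuous_on S (\<lambda>x. dir_deriv UNIV (\<lambda>y. dir_deriv UNIV f y v) x w)"
proof -
  define u where "u = (\<lambda>k::nat. if k = 0 then v else w)"
  have q: "dir_deriv S f y v = dir_deriv UNIV f y v" if "y \<in> S" for y
    by (rule dir_deriv_open[OF S that])
  show "(dir_quotient (\<lambda>y. dir_deriv UNIV f y v) x w \<longlongrightarrow>
      dir_deriv UNIV (\<lambda>y. dir_deriv UNIV f y v) x w) (at 0)" if x: "x \<in> S"
  proof -
    have "\<exists>l. (dir_quotient (\<lambda>y. iter_dir_deriv S f (Suc 0) y u) x (u (Suc 0)) \<longlongrightarrow> l) (dir_filter S x (u (Suc 0)))"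
      using f x unfolding smooth_on_def by blast
    then obtain l where "(dir_quotient (\<lambda>y. dir_deriv S f y v) x w \<longlongrightarrow> l) (at 0)"
      by (auto simp: u_def dir_filter_open[OF S x])
    then have "(dir_quotient (\<lambda>y. dir_deriv UNIV f y v) x w \<longlongrightarrow> l) (at 0)"
      using dir_quotient_tendsto_cong[OF S x q] by simp
    then show ?thesis using dir_deriv_eqI by metis
  qed
  have "continuous_on (S \<times> (UNIV \<rightarrow> UNIV)) (\<lambda>(x, v). iter_dir_deriv S f (Suc (Suc 0)) x v)"
    using f unfolding smooth_on_def by blast
  then have "continuous_on S (\<lambda>x. (\<lambda>(x, v). iter_dir_deriv S f (Suc (Suc 0)) x v) (x, u))"
    by (rule continuous_on_compose2) (auto intro!: continuous_intros)
  then show "continuous_on S (\<lambda>x. dir_deriv UNIV (\<lambda>y. dir_deriv UNIV f y v) x w)"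
  proof (rule continuous_on_eq)
    fix x assume x: "x \<in> S"
    then show "(\<lambda>(x, v). iter_dir_deriv S f (Suc (Suc 0)) x v) (x, u) =
        dir_deriv UNIV (\<lambda>y. dir_deriv UNIV f y v) x w"
      using dir_deriv_cong_open[OF S x, of "\<lambda>y. dir_deriv S f y v" "\<lambda>y. dir_deriv UNIV f y v" w, OF q]
      by (simp add: u_def dir_deriv_open[OF S x])
  qed
qed

text \<open>
  Schwarz's theorem. The second difference quotient in the directions \<open>w\<close> and \<open>v\<close> does not depend
  on the order of the two differences. By two applications of the mean value theorem it lies in any
  given convex neighbourhood of the derivative \<open>\<partial>\<^sub>w\<partial>\<^sub>v f x\<close> once both steps \<open>s, t\<close> are small. On the
  other hand, letting first \<open>s\<close> and then \<open>t\<close> tend to zero it approaches \<open>\<partial>\<^sub>v\<partial>\<^sub>w f x\<close>. Separating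
  the two values by disjoint open sets makes this a contradiction, without closures.
\<close>

lemma second_deriv_symmetric:
  fixes f :: "'a::locally_convex_space \<Rightarrow> 'b::locally_convex_space"
  assumes f: "smooth_on UNIV S f" and S: "open S" and x: "x \<in> S"
  shows "dir_deriv UNIV (\<lambda>y. dir_deriv UNIV f y v) x w = dir_deriv UNIV (\<lambda>y. dir_deriv UNIV f y w) x v"
proof (rule ccontr)
  let ?g = "\<lambda>y. dir_deriv UNIV f y v" and ?h = "\<lambda>y. dir_deriv UNIV f y w"
  let ?D = "\<lambda>y. dir_deriv UNIV ?g y w"
  note C1 = smooth_on_imp_C1_on[OF f S]
  assume "?D x \<noteq> dir_deriv UNIV ?h x v"
  then obtain U V where UV: "open U" "open V" "?D x \<in> U" "dir_deriv UNIV ?h x v \<in> V" "U \<inter> V = {}"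
    using hausdorff by metis
  obtain C where C: "convex C" "C \<subseteq> U" "?D x \<in> interior C"
    using convex_neighbourhood[OF UV(1,3)] by blast
  \<comment> \<open>The mean value theorem loses the interior, hence a second neighbourhood for the inner use.\<close>
  obtain C' where C': "convex C'" "C' \<subseteq> interior C" "?D x \<in> interior C'"
    using convex_neighbourhood[OF open_interior C(3)] by blast
  have "\<forall>\<^sub>F p in nhds (0::real, 0::real). x + fst p *\<^sub>R w + snd p *\<^sub>R v \<in> S \<inter> ?D -` interior C'"
  proof -
    have "((\<lambda>p. x + fst p *\<^sub>R w + snd p *\<^sub>R v) \<longlongrightarrow> x + 0 *\<^sub>R w + 0 *\<^sub>R v) (nhds (0::real, 0::real))"
      by (intro tendsto_add tendsto_scaleR_lcs tendsto_const tendsto_fst_nhds tendsto_snd_nhds)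
    moreover have "open (S \<inter> ?D -` interior C')"
      by (rule continuous_open_preimage[OF smooth_on_second_deriv_continuous[OF f S] S open_interior])
    ultimately show ?thesis by (rule topological_tendstoD) (use x C'(3) in simp)
  qed
  then obtain P Q where P: "eventually P (nhds (0::real))" and Q: "eventually Q (nhds (0::real))"
    and PQ: "\<And>s t. P s \<Longrightarrow> Q t \<Longrightarrow> x + s *\<^sub>R w + t *\<^sub>R v \<in> S \<inter> ?D -` interior C'"
    unfolding nhds_prod eventually_prod_filter by auto
  obtain d where d: "d > 0" "\<And>r. \<bar>r\<bar> < d \<Longrightarrow> P r \<and> Q r"
    using eventually_conj[OF P Q] unfolding eventually_nhds_metric by (auto simp: dist_real_def)
  have mem: "x + s *\<^sub>R w + t *\<^sub>R v \<in> S" "?D (x + s *\<^sub>R w + t *\<^sub>R v) \<in> interior C'" if "\<bar>s\<bar> < d" "\<bar>t\<bar> < d" for s t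
    using PQ[of s t] d(2)[OF that(1)] d(2)[OF that(2)] by auto
  have in_C: "dir_quotient (\<lambda>y. dir_quotient f y w s) x v t \<in> C" if s: "s \<noteq> 0" "\<bar>s\<bar> < d" and t: "t \<noteq> 0" "\<bar>t\<bar> < d" for s t
  proof (rule dir_mean_value_convex[OF C(1) t(1), where d = "\<lambda>r. dir_quotient ?g (x + r *\<^sub>R v) w s"])
    fix r assume "\<bar>r\<bar> \<le> \<bar>t\<bar>"
    then have r: "\<bar>r\<bar> < d" using t by simp
    let ?y = "x + r *\<^sub>R v"
    have y: "?y + q *\<^sub>R w \<in> S" "?D (?y + q *\<^sub>R w) \<in> interior C'" if "\<bar>q\<bar> \<le> \<bar>s\<bar>" for q
      using mem[of q r] that r s(2) by (simp_all add: add_ac)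
    show "(dir_quotient (\<lambda>y. dir_quotient f y w s) ?y v \<longlongrightarrow> dir_quotient ?g ?y w s) (at 0)"
    proof -
      have "((\<lambda>q. (dir_quotient f (?y + s *\<^sub>R w) v q - dir_quotient f ?y v q) /\<^sub>R s) \<longlongrightarrow>
          (?g (?y + s *\<^sub>R w) - ?g ?y) /\<^sub>R s) (at 0)"
        using y(1)[of s] y(1)[of 0]
        by (intro tendsto_scaleR_lcs tendsto_const tendsto_diff C1_onD[OF C1]) auto
      moreover have "(dir_quotient f (?y + s *\<^sub>R w) v q - dir_quotient f ?y v q) /\<^sub>R s =
          dir_quotient (\<lambda>y. dir_quotient f y w s) ?y v q" for q
        by (simp add: dir_quotient_def algebra_simps)
      ultimately show ?thesis by (simp add: dir_quotient_def[of ?g])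
    qed
    have "dir_quotient ?g ?y w s \<in> C'"
      using y by (intro dir_mean_value_convex[OF C'(1) s(1), where d = "\<lambda>q. ?D (?y + q *\<^sub>R w)"]
          smooth_on_second_deriv_tendsto[OF f S]) auto
    then show "dir_quotient ?g ?y w s \<in> interior C" using C'(2) by auto
  qed
  have ev: "eventually (\<lambda>t. t \<noteq> 0 \<and> \<bar>t\<bar> < d) (at 0)"
    unfolding eventually_at using d(1) by (intro exI[of _ d]) (auto simp: dist_real_def)
  have "eventually (\<lambda>t. dir_quotient ?h x v t \<in> V) (at 0)"
    using topological_tendstoD[OF smooth_on_second_deriv_tendsto[OF f S x] UV(2,4)] .
  from eventually_happens[OF eventually_conj[OF this ev]] obtain t
    where t: "dir_quotient ?h x v t \<in> V" "t \<noteq> 0" "\<bar>t\<bar> < d" by auto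
  have "((\<lambda>s. dir_quotient (\<lambda>y. dir_quotient f y w s) x v t) \<longlongrightarrow> dir_quotient ?h x v t) (at 0)"
    unfolding dir_quotient_def[of "\<lambda>y. dir_quotient f y w s" for s] dir_quotient_def[of ?h]
    using mem(1)[of 0 t] t d(1) x
    by (intro tendsto_scaleR_lcs tendsto_const tendsto_diff C1_onD[OF C1]) auto
  from eventually_happens[OF eventually_conj[OF topological_tendstoD[OF this UV(2) t(1)] ev]] obtain s
    where "dir_quotient (\<lambda>y. dir_quotient f y w s) x v t \<in> V" "s \<noteq> 0" "\<bar>s\<bar> < d" by auto
  with in_C[of s t] t C(2) UV(5) show False by auto
qed



lemma dir_quotient_slice:
  shows dir_quotient_slice_fst: "dir_quotient (\<lambda>x. f (x, b)) a v = dir_quotient f (a, b) (v, 0)"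
    and dir_quotient_slice_snd: "dir_quotient (\<lambda>y. f (a, y)) b v = dir_quotient f (a, b) (0, v)"
  by (simp_all add: fun_eq_iff dir_quotient_def)

lemma dir_deriv_slice:
  shows dir_deriv_slice_fst: "dir_deriv UNIV (\<lambda>x. f (x, b)) a v = dir_deriv UNIV f (a, b) (v, 0)"
    and dir_deriv_slice_snd: "dir_deriv UNIV (\<lambda>y. f (a, y)) b v = dir_deriv UNIV f (a, b) (0, v)"
  by (simp_all add: dir_deriv_def dir_filter_def dir_quotient_slice)

section \<open>Tangent spaces in charts\<close>

lemma is_chartD:
  assumes "is_chart \<kappa>"
  shows is_chart_inv_left: "p \<in> fst \<kappa> \<Longrightarrow> chart_inv \<kappa> (snd \<kappa> p) = p"
    and is_chart_open_image: "open (snd \<kappa> ` fst \<kappa>)"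
    and is_chart_inv_continuous: "continuous_on (snd \<kappa> ` fst \<kappa>) (chart_inv \<kappa>)"
  using assms by (auto simp: is_chart_def homeomorphism_def)

lemma is_chart_open_image_subset:
  assumes \<kappa>: "is_chart \<kappa>" and W: "open W"
  shows "open (snd \<kappa> ` (fst \<kappa> \<inter> W))"
proof -
  have "snd \<kappa> ` (fst \<kappa> \<inter> W) = snd \<kappa> ` fst \<kappa> \<inter> chart_inv \<kappa> -` W"
    using is_chart_inv_left[OF \<kappa>] by force
  also have "open \<dots>"
    by (rule continuous_open_preimage[OF is_chart_inv_continuous[OF \<kappa>] is_chart_open_image[OF \<kappa>] W])
  finally show ?thesis .
qed

lemma charts_at_is_chart: "smooth_atlas A \<Longrightarrow> \<kappa> \<in> charts_at A p \<Longrightarrow> is_chart \<kappa>"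
  by (auto simp: smooth_atlas_def charts_at_def)

lemma charts_at_inv: "smooth_atlas A \<Longrightarrow> \<kappa> \<in> charts_at A p \<Longrightarrow> chart_inv \<kappa> (snd \<kappa> p) = p"
  by (metis (no_types, lifting) charts_at_is_chart is_chart_inv_left charts_at_def mem_Collect_eq)

lemma charts_at_nonempty: "smooth_atlas A \<Longrightarrow> \<exists>\<kappa>. \<kappa> \<in> charts_at A p"
  unfolding smooth_atlas_def charts_at_def by blast

lemma transition_C1_on:
  assumes A: "smooth_atlas A" and "\<kappa> \<in> A" "\<mu> \<in> A"
  shows "C1_on (snd \<kappa> ` (fst \<kappa> \<inter> fst \<mu>)) (snd \<mu> \<circ> chart_inv \<kappa>)"
proof (rule smooth_on_imp_C1_on)
  show "smooth_on UNIV (snd \<kappa> ` (fst \<kappa> \<inter> fst \<mu>)) (snd \<mu> \<circ> chart_inv \<kappa>)"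
    using assms by (simp add: smooth_atlas_def)
  have "is_chart \<kappa>" "open (fst \<mu>)" using assms by (auto simp: smooth_atlas_def is_chart_def)
  then show "open (snd \<kappa> ` (fst \<kappa> \<inter> fst \<mu>))" by (rule is_chart_open_image_subset)
qed

text \<open>
  Order one suffices for translations: only their tangent maps occur in the invariance of a form.
\<close>

definition C1_map ::
    "('m::topological_space, 'e::locally_convex_space) chart set \<Rightarrow>
     ('n::topological_space, 'f::locally_convex_space) chart set \<Rightarrow> ('m \<Rightarrow> 'n) \<Rightarrow> bool" where
  "C1_map A B f \<longleftrightarrow> (\<forall>\<kappa>\<in>A. \<forall>\<mu>\<in>B.
     C1_on (snd \<kappa> ` (fst \<kappa> \<inter> f -` fst \<mu>)) (snd \<mu> \<circ> f \<circ> chart_inv \<kappa>))"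

lemma C1_map_id: "smooth_atlas A \<Longrightarrow> C1_map A A (\<lambda>x. x)"
  using transition_C1_on by (auto simp: C1_map_def comp_def vimage_def)

text \<open>
  The chain rule for \<open>f\<close> followed by a transition map. For \<open>f\<close> the identity it says that coordinate
  vectors define tangent vectors, and in general that tangent maps take values in the tangent space.
\<close>

lemma dir_deriv_change_chart:
  assumes A: "smooth_atlas A" and B: "smooth_atlas B" and f: "C1_map A B f"
    and \<kappa>: "\<kappa> \<in> charts_at A p" and \<mu>: "\<mu> \<in> charts_at B (f p)" and \<mu>': "\<mu>' \<in> charts_at B (f p)"
  shows "dir_deriv UNIV (snd \<mu>' \<circ> f \<circ> chart_inv \<kappa>) (snd \<kappa> p) x =
    dir_deriv UNIV (snd \<mu>' \<circ> chart_inv \<mu>) (snd \<mu> (f p))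
      (dir_deriv UNIV (snd \<mu> \<circ> f \<circ> chart_inv \<kappa>) (snd \<kappa> p) x)"
proof -
  let ?f = "snd \<mu> \<circ> f \<circ> chart_inv \<kappa>" and ?g = "snd \<mu>' \<circ> chart_inv \<mu>"
  let ?S = "snd \<kappa> ` (fst \<kappa> \<inter> f -` fst \<mu>)"
  have mem: "p \<in> fst \<kappa>" "\<kappa> \<in> A" "f p \<in> fst \<mu>" "\<mu> \<in> B" "f p \<in> fst \<mu>'" "\<mu>' \<in> B"
    using \<kappa> \<mu> \<mu>' by (auto simp: charts_at_def)
  have S: "C1_on ?S ?f" "snd \<kappa> p \<in> ?S"
    using f mem by (auto simp: C1_map_def)
  have f_p: "?f (snd \<kappa> p) = snd \<mu> (f p)" using charts_at_inv[OF A \<kappa>] by simp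
  have "dir_deriv UNIV (snd \<mu>' \<circ> f \<circ> chart_inv \<kappa>) (snd \<kappa> p) x =
      dir_deriv UNIV (\<lambda>y. ?g (?f y)) (snd \<kappa> p) x"
  proof (rule dir_deriv_cong_open)
    show "open ?S" using S(1) by (simp add: C1_on_def)
    show "(snd \<mu>' \<circ> f \<circ> chart_inv \<kappa>) y = ?g (?f y)" if "y \<in> ?S" for y
      using that is_chart_inv_left[OF charts_at_is_chart[OF A \<kappa>]]
        is_chart_inv_left[OF charts_at_is_chart[OF B \<mu>]] by auto
  qed (rule S(2))
  also have "\<dots> = dir_deriv UNIV ?g (?f (snd \<kappa> p)) (dir_deriv UNIV ?f (snd \<kappa> p) x)"
  proof (rule dir_deriv_chain[OF C1_onD[OF S] transition_C1_on[OF B mem(4,6)]])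
    show "?f (snd \<kappa> p) \<in> snd \<mu> ` (fst \<mu> \<inter> fst \<mu>')" unfolding f_p using mem by blast
  qed
  finally show ?thesis unfolding f_p .
qed

lemma tangent_of_coord_in_tangent_space:
  assumes A: "smooth_atlas A" and \<kappa>: "\<kappa> \<in> charts_at A p"
  shows "tangent_of_coord A \<kappa> p x \<in> tangent_space A p"
proof -
  have change: "dir_deriv UNIV (snd \<mu>' \<circ> chart_inv \<kappa>) (snd \<kappa> p) x = dir_deriv UNIV (snd \<mu>' \<circ> chart_inv \<mu>) (snd \<mu> p)
      (dir_deriv UNIV (snd \<mu> \<circ> chart_inv \<kappa>) (snd \<kappa> p) x)"
    if "\<mu> \<in> charts_at A p" "\<mu>' \<in> charts_at A p" for \<mu> \<mu>'
    using dir_deriv_change_chart[OF A A C1_map_id[OF A] \<kappa> that, of x] by (simp only: comp_def)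
  show ?thesis
    unfolding tangent_space_def tangent_of_coord_def by (simp, intro ballI change)
qed

lemma tangent_of_coord_self:
  assumes A: "smooth_atlas A" and \<kappa>: "\<kappa> \<in> charts_at A p"
  shows "tangent_of_coord A \<kappa> p x \<kappa> = x"
proof -
  have "dir_deriv UNIV (snd \<kappa> \<circ> chart_inv \<kappa>) (snd \<kappa> p) x = dir_deriv UNIV (\<lambda>y. y) (snd \<kappa> p) x"
    using \<kappa> is_chart_inv_left[OF charts_at_is_chart[OF A \<kappa>]]
    by (intro dir_deriv_cong_open[OF is_chart_open_image[OF charts_at_is_chart[OF A \<kappa>]]])
      (auto simp: charts_at_def)
  then show ?thesis using \<kappa> by (simp add: tangent_of_coord_def dir_deriv_id)
qed

lemma tangent_of_coord_of_tangent:
  assumes "v \<in> tangent_space A p" "\<kappa> \<in> charts_at A p"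
  shows "tangent_of_coord A \<kappa> p (v \<kappa>) = v"
proof
  fix \<mu>
  have "v \<mu> = dir_deriv UNIV (snd \<mu> \<circ> chart_inv \<kappa>) (snd \<kappa> p) (v \<kappa>)" if "\<mu> \<in> charts_at A p"
    using assms that unfolding tangent_space_def by blast
  moreover have "v \<mu> = 0" if "\<mu> \<notin> charts_at A p"
    using assms(1) that unfolding tangent_space_def by blast
  ultimately show "tangent_of_coord A \<kappa> p (v \<kappa>) \<mu> = v \<mu>"
    unfolding tangent_of_coord_def by metis
qed

lemma tangent_of_coord_lincomb:
  assumes A: "smooth_atlas A" and \<kappa>: "\<kappa> \<in> charts_at A p"
  shows "tangent_of_coord A \<kappa> p (a *\<^sub>R x + b *\<^sub>R y) =
    a *\<^sub>R tangent_of_coord A \<kappa> p x + b *\<^sub>R tangent_of_coord A \<kappa> p y"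
proof -
  have "dir_deriv UNIV (snd \<mu> \<circ> chart_inv \<kappa>) (snd \<kappa> p) (a *\<^sub>R x + b *\<^sub>R y) =
      a *\<^sub>R dir_deriv UNIV (snd \<mu> \<circ> chart_inv \<kappa>) (snd \<kappa> p) x +
      b *\<^sub>R dir_deriv UNIV (snd \<mu> \<circ> chart_inv \<kappa>) (snd \<kappa> p) y" if "\<mu> \<in> charts_at A p" for \<mu>
  proof -
    have *: "\<kappa> \<in> A" "\<mu> \<in> A" "snd \<kappa> p \<in> snd \<kappa> ` (fst \<kappa> \<inter> fst \<mu>)"
      using that \<kappa> by (auto simp: charts_at_def)
    note T = transition_C1_on[OF A *(1,2)] *(3)
    show ?thesis by (simp add: dir_deriv_add[OF T] dir_deriv_scaleR[OF T])
  qed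
  then show ?thesis by (auto simp: tangent_of_coord_def fun_eq_iff scaleR_fun_def)
qed

lemma tangent_map_in_tangent_space:
  assumes A: "smooth_atlas A" and B: "smooth_atlas B" and f: "C1_map A B f"
  shows "tangent_map A B f p v \<in> tangent_space B (f p)"
proof -
  have \<kappa>: "(SOME \<kappa>. \<kappa> \<in> charts_at A p) \<in> charts_at A p"
    using charts_at_nonempty[OF A] by (rule someI_ex)
  show ?thesis
    unfolding tangent_map_def tangent_space_def Let_def
    by (simp, intro ballI dir_deriv_change_chart[OF A B f \<kappa>])
qed

section \<open>Multiplication in charts\<close>

lemma chart_inv_prod:
  assumes \<kappa>: "is_chart \<kappa>" and \<mu>: "is_chart \<mu>" and "x \<in> snd \<kappa> ` fst \<kappa>" "y \<in> snd \<mu> ` fst \<mu>"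
  shows "chart_inv (fst \<kappa> \<times> fst \<mu>, map_prod (snd \<kappa>) (snd \<mu>)) (x, y) = (chart_inv \<kappa> x, chart_inv \<mu> y)"
proof -
  have "inj_on (snd \<kappa>) (fst \<kappa>)" "inj_on (snd \<mu>) (fst \<mu>)"
    using is_chart_inv_left[OF \<kappa>] is_chart_inv_left[OF \<mu>] by (metis inj_onI)+
  then have "inj_on (map_prod (snd \<kappa>) (snd \<mu>)) (fst \<kappa> \<times> fst \<mu>)" by (rule map_prod_inj_on)
  then show ?thesis
    unfolding chart_inv_def[of "(_, _)"] fst_conv snd_conv
    by (rule inv_into_f_eq) (use assms is_chart_inv_left[OF \<kappa>] is_chart_inv_left[OF \<mu>] in auto)
qed

locale lie_group_data =
  fixes G :: "('g::t2_space, 'e::locally_convex_space) lie_data"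
  assumes lie_group: "lie_group G"
begin

abbreviation "A \<equiv> gatlas G"

lemma atlas: "smooth_atlas A"
  using lie_group by (simp add: lie_group_def)

sublocale group "gmult G" "gone G" "ginv G"
  using lie_group by (simp add: lie_group_def)

definition mult_dom :: "('g, 'e) chart \<Rightarrow> ('g, 'e) chart \<Rightarrow> ('g, 'e) chart \<Rightarrow> ('e \<times> 'e) set" where
  "mult_dom \<kappa> \<mu> \<nu> = {(x, y). x \<in> snd \<kappa> ` fst \<kappa> \<and> y \<in> snd \<mu> ` fst \<mu> \<and>
     gmult G (chart_inv \<kappa> x) (chart_inv \<mu> y) \<in> fst \<nu>}"

definition mult_chart :: "('g, 'e) chart \<Rightarrow> ('g, 'e) chart \<Rightarrow> ('g, 'e) chart \<Rightarrow> 'e \<times> 'e \<Rightarrow> 'e" where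
  "mult_chart \<kappa> \<mu> \<nu> =
     snd \<nu> \<circ> (\<lambda>(x, y). gmult G x y) \<circ> chart_inv (fst \<kappa> \<times> fst \<mu>, map_prod (snd \<kappa>) (snd \<mu>))"

lemma mult_chart_eq:
  assumes "\<kappa> \<in> A" "\<mu> \<in> A" "(x, y) \<in> mult_dom \<kappa> \<mu> \<nu>"
  shows "mult_chart \<kappa> \<mu> \<nu> (x, y) = snd \<nu> (gmult G (chart_inv \<kappa> x) (chart_inv \<mu> y))"
proof -
  have "is_chart \<kappa>" "is_chart \<mu>" using assms atlas by (auto simp: smooth_atlas_def)
  from chart_inv_prod[OF this] show ?thesis
    using assms(3) by (auto simp: mult_dom_def mult_chart_def)
qed

lemma mult_continuous: "continuous_on UNIV (\<lambda>(x, y). gmult G x y)"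
  using lie_group by (simp add: lie_group_def smooth_map_def)

lemma mult_chart_smooth:
  assumes \<kappa>: "\<kappa> \<in> A" and \<mu>: "\<mu> \<in> A" and \<nu>: "\<nu> \<in> A"
  shows mult_dom_open: "open (mult_dom \<kappa> \<mu> \<nu>)"
    and "smooth_on UNIV (mult_dom \<kappa> \<mu> \<nu>) (mult_chart \<kappa> \<mu> \<nu>)"
proof -
  have charts: "is_chart \<kappa>" "is_chart \<mu>" "open (fst \<nu>)"
    using assms atlas by (auto simp: smooth_atlas_def is_chart_def)
  have smooth: "smooth_map (prod_atlas A A) A (\<lambda>(x, y). gmult G x y)"
    using lie_group by (simp add: lie_group_def)
  have dom: "mult_dom \<kappa> \<mu> \<nu> = map_prod (snd \<kappa>) (snd \<mu>) `
      (fst \<kappa> \<times> fst \<mu> \<inter> (\<lambda>(x, y). gmult G x y) -` fst \<nu>)"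
  proof (intro set_eqI iffI)
    fix z assume "z \<in> mult_dom \<kappa> \<mu> \<nu>"
    then obtain p q where "z = (snd \<kappa> p, snd \<mu> q)" "p \<in> fst \<kappa>" "q \<in> fst \<mu>" "gmult G p q \<in> fst \<nu>"
      by (auto simp: mult_dom_def is_chart_inv_left[OF charts(1)] is_chart_inv_left[OF charts(2)])
    then show "z \<in> map_prod (snd \<kappa>) (snd \<mu>) ` (fst \<kappa> \<times> fst \<mu> \<inter> (\<lambda>(x, y). gmult G x y) -` fst \<nu>)"
      by (intro image_eqI[of _ _ "(p, q)"]) auto
  qed (auto simp: mult_dom_def is_chart_inv_left[OF charts(1)] is_chart_inv_left[OF charts(2)])
  have "(fst \<kappa> \<times> fst \<mu>, map_prod (snd \<kappa>) (snd \<mu>)) \<in> prod_atlas A A"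
    using \<kappa> \<mu> unfolding prod_atlas_def by blast
  from smooth[unfolded smooth_map_def, THEN conjunct2, THEN bspec, OF this, THEN bspec, OF \<nu>]
  show "smooth_on UNIV (mult_dom \<kappa> \<mu> \<nu>) (mult_chart \<kappa> \<mu> \<nu>)"
    by (simp only: mult_chart_def dom fst_conv snd_conv)
  let ?D = "snd \<kappa> ` fst \<kappa> \<times> snd \<mu> ` fst \<mu>"
  have "continuous_on ?D (\<lambda>z. (\<lambda>(x, y). gmult G x y) (chart_inv \<kappa> (fst z), chart_inv \<mu> (snd z)))"
  proof (rule continuous_on_compose2[OF mult_continuous])
    show "continuous_on ?D (\<lambda>z. (chart_inv \<kappa> (fst z), chart_inv \<mu> (snd z)))"
      by (intro continuous_on_Pair continuous_on_compose2[OF is_chart_inv_continuous[OF charts(1)]]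
          continuous_on_compose2[OF is_chart_inv_continuous[OF charts(2)]] continuous_intros) auto
  qed simp
  moreover have "open ?D" using charts by (intro open_Times is_chart_open_image)
  ultimately have "open (?D \<inter> (\<lambda>z. (\<lambda>(x, y). gmult G x y) (chart_inv \<kappa> (fst z), chart_inv \<mu> (snd z))) -` fst \<nu>)"
    using charts(3) by (rule continuous_open_preimage)
  also have "?D \<inter> (\<lambda>z. (\<lambda>(x, y). gmult G x y) (chart_inv \<kappa> (fst z), chart_inv \<mu> (snd z))) -` fst \<nu> = mult_dom \<kappa> \<mu> \<nu>"
    by (auto simp: mult_dom_def)
  finally show "open (mult_dom \<kappa> \<mu> \<nu>)" .
qed

text \<open>
  Translation by \<open>g\<close> is the multiplication with one argument fixed, which in a chart \<open>\<nu>\<close> at \<open>g\<close> is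
  composition with an affine embedding.
\<close>

lemma C1_map_left: "C1_map A A (gmult G g)"
  unfolding C1_map_def
proof (intro ballI)
  fix \<kappa> \<mu> assume \<kappa>: "\<kappa> \<in> A" and \<mu>: "\<mu> \<in> A"
  obtain \<nu> where \<nu>: "\<nu> \<in> A" "g \<in> fst \<nu>" using charts_at_nonempty[OF atlas, of g] unfolding charts_at_def by blast
  have charts: "is_chart \<nu>" "is_chart \<kappa>" "open (fst \<mu>)"
    using \<kappa> \<mu> \<nu> atlas by (auto simp: smooth_atlas_def is_chart_def)
  have "C1_on ((\<lambda>x. (snd \<nu> g, x)) -` mult_dom \<nu> \<kappa> \<mu>) (\<lambda>x. mult_chart \<nu> \<kappa> \<mu> (snd \<nu> g, x))"
    by (rule C1_on_compose_affine[OF smooth_on_imp_C1_on[OF mult_chart_smooth(2,1)[OF \<nu>(1) \<kappa> \<mu>]], of _ "\<lambda>v. (0, v)"])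
      (auto intro!: continuous_intros)
  then show "C1_on (snd \<kappa> ` (fst \<kappa> \<inter> gmult G g -` fst \<mu>)) (snd \<mu> \<circ> gmult G g \<circ> chart_inv \<kappa>)"
  proof (rule C1_on_subset_cong)
    have "continuous_on UNIV (\<lambda>x. (\<lambda>(x, y). gmult G x y) (g, x))"
      by (rule continuous_on_compose2[OF mult_continuous]) (auto intro!: continuous_intros)
    then have "open (gmult G g -` fst \<mu>)" using charts(3) by (simp add: open_vimage)
    then show "open (snd \<kappa> ` (fst \<kappa> \<inter> gmult G g -` fst \<mu>))"
      by (rule is_chart_open_image_subset[OF charts(2)])
    show sub: "snd \<kappa> ` (fst \<kappa> \<inter> gmult G g -` fst \<mu>) \<subseteq> (\<lambda>x. (snd \<nu> g, x)) -` mult_dom \<nu> \<kappa> \<mu>"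
      using \<nu> is_chart_inv_left[OF charts(1)] is_chart_inv_left[OF charts(2)] by (auto simp: mult_dom_def)
    fix x assume "x \<in> snd \<kappa> ` (fst \<kappa> \<inter> gmult G g -` fst \<mu>)"
    then show "mult_chart \<nu> \<kappa> \<mu> (snd \<nu> g, x) = (snd \<mu> \<circ> gmult G g \<circ> chart_inv \<kappa>) x"
      using sub mult_chart_eq[OF \<nu>(1) \<kappa>, of "snd \<nu> g" x \<mu>] is_chart_inv_left[OF charts(1) \<nu>(2)] by auto
  qed
qed

lemma C1_map_right: "C1_map A A (\<lambda>x. gmult G x g)"
  unfolding C1_map_def
proof (intro ballI)
  fix \<kappa> \<mu> assume \<kappa>: "\<kappa> \<in> A" and \<mu>: "\<mu> \<in> A"
  obtain \<nu> where \<nu>: "\<nu> \<in> A" "g \<in> fst \<nu>" using charts_at_nonempty[OF atlas, of g] unfolding charts_at_def by blast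
  have charts: "is_chart \<nu>" "is_chart \<kappa>" "open (fst \<mu>)"
    using \<kappa> \<mu> \<nu> atlas by (auto simp: smooth_atlas_def is_chart_def)
  have "C1_on ((\<lambda>x. (x, snd \<nu> g)) -` mult_dom \<kappa> \<nu> \<mu>) (\<lambda>x. mult_chart \<kappa> \<nu> \<mu> (x, snd \<nu> g))"
    by (rule C1_on_compose_affine[OF smooth_on_imp_C1_on[OF mult_chart_smooth(2,1)[OF \<kappa> \<nu>(1) \<mu>]], of _ "\<lambda>v. (v, 0)"])
      (auto intro!: continuous_intros)
  then show "C1_on (snd \<kappa> ` (fst \<kappa> \<inter> (\<lambda>x. gmult G x g) -` fst \<mu>)) (snd \<mu> \<circ> (\<lambda>x. gmult G x g) \<circ> chart_inv \<kappa>)"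
  proof (rule C1_on_subset_cong)
    have "continuous_on UNIV (\<lambda>x. (\<lambda>(x, y). gmult G x y) (x, g))"
      by (rule continuous_on_compose2[OF mult_continuous]) (auto intro!: continuous_intros)
    then have "open ((\<lambda>x. gmult G x g) -` fst \<mu>)" using charts(3) by (simp add: open_vimage)
    then show "open (snd \<kappa> ` (fst \<kappa> \<inter> (\<lambda>x. gmult G x g) -` fst \<mu>))"
      by (rule is_chart_open_image_subset[OF charts(2)])
    show sub: "snd \<kappa> ` (fst \<kappa> \<inter> (\<lambda>x. gmult G x g) -` fst \<mu>) \<subseteq> (\<lambda>x. (x, snd \<nu> g)) -` mult_dom \<kappa> \<nu> \<mu>"
      using \<nu> is_chart_inv_left[OF charts(1)] is_chart_inv_left[OF charts(2)] by (auto simp: mult_dom_def)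
    fix x assume "x \<in> snd \<kappa> ` (fst \<kappa> \<inter> (\<lambda>x. gmult G x g) -` fst \<mu>)"
    then show "mult_chart \<kappa> \<nu> \<mu> (x, snd \<nu> g) = (snd \<mu> \<circ> (\<lambda>x. gmult G x g) \<circ> chart_inv \<kappa>) x"
      using sub mult_chart_eq[OF \<kappa> \<nu>(1), of x "snd \<nu> g" \<mu>] is_chart_inv_left[OF charts(1) \<nu>(2)] by auto
  qed
qed

section \<open>The Lie bracket in a chart at the unit\<close>

text \<open>
  The same choice as in \<^const>\<open>tangent_map\<close> at the unit. Thus the derivatives in the
  definition of left-invariant fields are already expressed in this chart.
\<close>

definition unit_chart :: "('g, 'e) chart" where
  "unit_chart = (SOME \<kappa>. \<kappa> \<in> charts_at A (gone G))"

abbreviation unit_coord :: 'e where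
  "unit_coord \<equiv> snd unit_chart (gone G)"

abbreviation unit_dom :: "'e set" where
  "unit_dom \<equiv> snd unit_chart ` fst unit_chart"

lemma unit_chart_at: "unit_chart \<in> charts_at A (gone G)"
  unfolding unit_chart_def using charts_at_nonempty[OF atlas] by (rule someI_ex)

lemma unit_chart_facts:
  shows unit_chart_atlas: "unit_chart \<in> A"
    and unit_coord_mem: "unit_coord \<in> unit_dom"
    and unit_chart_inv: "chart_inv unit_chart unit_coord = gone G"
    and unit_dom_open: "open unit_dom"
    and is_chart_unit: "is_chart unit_chart"
  using unit_chart_at charts_at_inv[OF atlas unit_chart_at]
    is_chart_open_image[OF charts_at_is_chart[OF atlas unit_chart_at]]
    charts_at_is_chart[OF atlas unit_chart_at]
  by (simp_all add: charts_at_def)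

lemma unit_chart_point:
  assumes "a \<in> unit_dom"
  shows "unit_chart \<in> charts_at A (chart_inv unit_chart a)"
    and "snd unit_chart (chart_inv unit_chart a) = a"
    and "chart_inv unit_chart a \<in> fst unit_chart"
  using assms unit_chart_atlas is_chart_inv_left[OF is_chart_unit] by (auto simp: charts_at_def)

abbreviation unit_mult :: "'e \<times> 'e \<Rightarrow> 'e" where
  "unit_mult \<equiv> mult_chart unit_chart unit_chart unit_chart"

abbreviation unit_mult_dom :: "('e \<times> 'e) set" where
  "unit_mult_dom \<equiv> mult_dom unit_chart unit_chart unit_chart"

lemma unit_mult_dom_mem:
  assumes "a \<in> unit_dom"
  shows "(a, unit_coord) \<in> unit_mult_dom" "(unit_coord, a) \<in> unit_mult_dom"
  using assms unit_coord_mem unit_chart_point(3)[OF assms] by (auto simp: mult_dom_def unit_chart_inv)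

lemmas unit_mult_smooth = mult_chart_smooth(2)[OF unit_chart_atlas unit_chart_atlas unit_chart_atlas]
lemmas unit_mult_dom_open = mult_chart_smooth(1)[OF unit_chart_atlas unit_chart_atlas unit_chart_atlas]
lemmas unit_mult_eq = mult_chart_eq[OF unit_chart_atlas unit_chart_atlas]

text \<open>
  The left-invariant and the right-invariant vector field with value \<open>w\<close> at the unit, in coordinates;
  and the mixed second derivative of the product at the unit.
\<close>

definition coord_left :: "'e \<Rightarrow> 'e \<Rightarrow> 'e" where
  "coord_left w a = dir_deriv UNIV
     (snd unit_chart \<circ> gmult G (chart_inv unit_chart a) \<circ> chart_inv unit_chart) unit_coord w"

definition coord_right :: "'e \<Rightarrow> 'e \<Rightarrow> 'e" where
  "coord_right w a = dir_deriv UNIV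
     (snd unit_chart \<circ> (\<lambda>x. gmult G x (chart_inv unit_chart a)) \<circ> chart_inv unit_chart) unit_coord w"

definition mixed_deriv :: "'e \<Rightarrow> 'e \<Rightarrow> 'e" where
  "mixed_deriv u w = dir_deriv UNIV (\<lambda>q. dir_deriv UNIV unit_mult q (0, w)) (unit_coord, unit_coord) (u, 0)"

text \<open>
  The two fields are partial derivatives of one smooth function of two variables. Hence
  their derivatives at the unit are mixed second derivatives of it, taken in opposite orders.
\<close>

lemma coord_left_eq:
  assumes a: "a \<in> unit_dom"
  shows "coord_left w a = dir_deriv UNIV unit_mult (a, unit_coord) (0, w)"
proof -
  let ?S = "Pair a -` unit_mult_dom"
  have "open ?S" by (intro open_vimage unit_mult_dom_open continuous_intros)
  moreover have "unit_coord \<in> ?S" using unit_mult_dom_mem[OF a] by simp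
  ultimately have "coord_left w a = dir_deriv UNIV (\<lambda>y. unit_mult (a, y)) unit_coord w"
    unfolding coord_left_def by (rule dir_deriv_cong_open) (simp add: unit_mult_eq)
  then show ?thesis by (simp only: dir_deriv_slice_snd)
qed

lemma coord_right_eq:
  assumes a: "a \<in> unit_dom"
  shows "coord_right w a = dir_deriv UNIV unit_mult (unit_coord, a) (w, 0)"
proof -
  let ?S = "(\<lambda>x. (x, a)) -` unit_mult_dom"
  have "open ?S" by (intro open_vimage unit_mult_dom_open continuous_intros)
  moreover have "unit_coord \<in> ?S" using unit_mult_dom_mem[OF a] by simp
  ultimately have "coord_right w a = dir_deriv UNIV (\<lambda>x. unit_mult (x, a)) unit_coord w"
    unfolding coord_right_def by (rule dir_deriv_cong_open) (simp add: unit_mult_eq)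
  then show ?thesis by (simp only: dir_deriv_slice_fst)
qed

lemma coord_left_deriv: "(dir_quotient (coord_left w) unit_coord u \<longlongrightarrow> mixed_deriv u w) (at 0)"
proof -
  have "(dir_quotient (\<lambda>a. dir_deriv UNIV unit_mult (a, unit_coord) (0, w)) unit_coord u \<longlongrightarrow> mixed_deriv u w) (at 0)"
    unfolding dir_quotient_slice_fst[of "\<lambda>q. dir_deriv UNIV unit_mult q (0, w)"] mixed_deriv_def
    by (rule smooth_on_second_deriv_tendsto[OF unit_mult_smooth unit_mult_dom_open unit_mult_dom_mem(1)[OF unit_coord_mem]])
  then show ?thesis
    using dir_quotient_tendsto_cong[OF unit_dom_open unit_coord_mem coord_left_eq] by simp
qed

text \<open>
  Compared with \<open>coord_left_deriv\<close> the arguments of \<^const>\<open>mixed_deriv\<close> are exchanged. This is where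
  the symmetry of second derivatives enters, and it makes the difference of the two derivatives
  a bracket.
\<close>

lemma coord_right_deriv: "(dir_quotient (coord_right w) unit_coord u \<longlongrightarrow> mixed_deriv w u) (at 0)"
proof -
  note smooth = unit_mult_smooth unit_mult_dom_open unit_mult_dom_mem(1)[OF unit_coord_mem]
  have "(dir_quotient (\<lambda>a. dir_deriv UNIV unit_mult (unit_coord, a) (w, 0)) unit_coord u \<longlongrightarrow> mixed_deriv w u) (at 0)"
    unfolding dir_quotient_slice_snd[of "\<lambda>q. dir_deriv UNIV unit_mult q (w, 0)"] mixed_deriv_def
      second_deriv_symmetric[OF smooth, of "(0, u)" "(w, 0)"]
    by (rule smooth_on_second_deriv_tendsto[OF smooth])
  then show ?thesis
    using dir_quotient_tendsto_cong[OF unit_dom_open unit_coord_mem coord_right_eq] by simp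
qed

lemma coord_left_unit: "coord_left w unit_coord = w"
proof -
  have "coord_left w unit_coord = dir_deriv UNIV (\<lambda>y. y) unit_coord w"
    unfolding coord_left_def unit_chart_inv
    by (rule dir_deriv_cong_open[OF unit_dom_open unit_coord_mem]) (simp add: unit_chart_point)
  then show ?thesis by (simp add: dir_deriv_id)
qed

lemma coord_right_unit: "coord_right w unit_coord = w"
proof -
  have "coord_right w unit_coord = dir_deriv UNIV (\<lambda>y. y) unit_coord w"
    unfolding coord_right_def unit_chart_inv
    by (rule dir_deriv_cong_open[OF unit_dom_open unit_coord_mem]) (simp add: unit_chart_point)
  then show ?thesis by (simp add: dir_deriv_id)
qed

lemma tangent_map_unit:
  assumes f: "C1_map A A f" and "unit_chart \<in> charts_at A (f (gone G))"
  shows "tangent_map A A f (gone G) v = tangent_of_coord A unit_chart (f (gone G))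
    (dir_deriv UNIV (snd unit_chart \<circ> f \<circ> chart_inv unit_chart) unit_coord (v unit_chart))"
proof -
  have "tangent_map A A f (gone G) v unit_chart =
      dir_deriv UNIV (snd unit_chart \<circ> f \<circ> chart_inv unit_chart) unit_coord (v unit_chart)"
    using assms(2) by (simp add: tangent_map_def unit_chart_def Let_def)
  then show ?thesis
    using tangent_of_coord_of_tangent[OF tangent_map_in_tangent_space[OF atlas atlas f] assms(2)] by metis
qed

lemma tangent_map_left:
  assumes "a \<in> unit_dom"
  shows "tangent_map A A (gmult G (chart_inv unit_chart a)) (gone G) v =
    tangent_of_coord A unit_chart (chart_inv unit_chart a) (coord_left (v unit_chart) a)"
  using tangent_map_unit[OF C1_map_left, of "chart_inv unit_chart a" v] unit_chart_point(1)[OF assms]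
  by (simp add: coord_left_def)

lemma tangent_map_right:
  assumes "a \<in> unit_dom"
  shows "tangent_map A A (\<lambda>x. gmult G x (chart_inv unit_chart a)) (gone G) v =
    tangent_of_coord A unit_chart (chart_inv unit_chart a) (coord_right (v unit_chart) a)"
  using tangent_map_unit[OF C1_map_right, of "chart_inv unit_chart a" v] unit_chart_point(1)[OF assms]
  by (simp add: coord_right_def)

lemma lie_bracket_coord:
  "lie_bracket G v w unit_chart =
    mixed_deriv (v unit_chart) (w unit_chart) - mixed_deriv (w unit_chart) (v unit_chart)"
proof -
  have field: "left_invariant_field G v (chart_inv unit_chart a) unit_chart = coord_left (v unit_chart) a"
    if "a \<in> unit_dom" for v a
    unfolding left_invariant_field_def tangent_map_left[OF that]
    by (rule tangent_of_coord_self[OF atlas unit_chart_point(1)[OF that]])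
  have at_unit: "left_invariant_field G v (gone G) unit_chart = v unit_chart" for v
    using field[OF unit_coord_mem, of v] by (simp add: unit_chart_inv coord_left_unit)
  have "dir_deriv UNIV (\<lambda>x. left_invariant_field G w (chart_inv unit_chart x) unit_chart) unit_coord u =
      mixed_deriv u (w unit_chart)" for w u
    using dir_deriv_cong_open[OF unit_dom_open unit_coord_mem field] dir_deriv_eqI[OF coord_left_deriv] by simp
  then show ?thesis
    using unit_chart_at by (simp add: lie_bracket_def vf_bracket_def at_unit)
qed

end

section \<open>Bi-invariant forms\<close>

text \<open>
  Formally one differentiates \<open>\<Omega> a (p\<^sub>1 a) (p\<^sub>2 a) = \<Omega> a (q\<^sub>1 a) (q\<^sub>2 a)\<close> at \<open>a = e\<close>. The derivative of
  \<open>\<Omega>\<close> in its base point would occur on both sides and cancel, since \<open>p\<^sub>i\<close> and \<open>q\<^sub>i\<close> agree at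
  \<open>e\<close>. The proof cancels before passing to the limit, by expanding
  \<open>\<Omega> a (p\<^sub>1 a) (p\<^sub>2 a) - \<Omega> a (q\<^sub>1 a) (q\<^sub>2 a)\<close> as \<open>\<Omega> a (p\<^sub>1 a - q\<^sub>1 a) (p\<^sub>2 a) + \<Omega> a (q\<^sub>1 a) (p\<^sub>2 a - q\<^sub>2 a)\<close>
  at a common base point \<open>a\<close>.
\<close>

lemma bilinear_invariance_derivative:
  fixes \<Omega> :: "'e::locally_convex_space \<Rightarrow> 'e \<Rightarrow> 'e \<Rightarrow> real"
  assumes K: "open K" "e \<in> K"
    and cont: "continuous_on (K \<times> UNIV) (\<lambda>(a, v, w). \<Omega> a v w)"
    and lin1: "\<And>a x y z r s. a \<in> K \<Longrightarrow> \<Omega> a (r *\<^sub>R x + s *\<^sub>R y) z = r * \<Omega> a x z + s * \<Omega> a y z"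
    and lin2: "\<And>a x y z r s. a \<in> K \<Longrightarrow> \<Omega> a z (r *\<^sub>R x + s *\<^sub>R y) = r * \<Omega> a z x + s * \<Omega> a z y"
    and inv: "\<And>a. a \<in> K \<Longrightarrow> \<Omega> a (p\<^sub>1 a) (p\<^sub>2 a) = \<Omega> a (q\<^sub>1 a) (q\<^sub>2 a)"
    and init: "p\<^sub>1 e = v" "q\<^sub>1 e = v" "p\<^sub>2 e = w" "q\<^sub>2 e = w"
    and p1: "(dir_quotient p\<^sub>1 e u \<longlongrightarrow> p\<^sub>1') (at 0)" and q1: "(dir_quotient q\<^sub>1 e u \<longlongrightarrow> q\<^sub>1') (at 0)"
    and p2: "(dir_quotient p\<^sub>2 e u \<longlongrightarrow> p\<^sub>2') (at 0)" and q2: "(dir_quotient q\<^sub>2 e u \<longlongrightarrow> q\<^sub>2') (at 0)"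
  shows "\<Omega> e (p\<^sub>1' - q\<^sub>1') w + \<Omega> e v (p\<^sub>2' - q\<^sub>2') = 0"
proof -
  define a where "a t = e + t *\<^sub>R u" for t
  define X where "X t = dir_quotient p\<^sub>1 e u t - dir_quotient q\<^sub>1 e u t" for t
  define Y where "Y t = dir_quotient p\<^sub>2 e u t - dir_quotient q\<^sub>2 e u t" for t
  have a: "(a \<longlongrightarrow> e) (at 0)" unfolding a_def by (rule tendsto_line_at)
  have a_K: "\<forall>\<^sub>F t in at 0. a t \<in> K" by (rule topological_tendstoD[OF a K])
  have ne: "\<forall>\<^sub>F t in at 0. t \<noteq> (0::real)" by (simp add: eventually_at_filter)
  have X: "(X \<longlongrightarrow> p\<^sub>1' - q\<^sub>1') (at 0)" unfolding X_def by (intro tendsto_diff p1 q1)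
  have Y: "(Y \<longlongrightarrow> p\<^sub>2' - q\<^sub>2') (at 0)" unfolding Y_def by (intro tendsto_diff p2 q2)
  have along: "((\<lambda>t. f (a t)) \<longlongrightarrow> f e) (at 0)" if f: "(dir_quotient f e u \<longlongrightarrow> f') (at 0)" for f :: "'e \<Rightarrow> 'e" and f'
  proof -
    have "((\<lambda>t. f e + t *\<^sub>R dir_quotient f e u t) \<longlongrightarrow> f e + 0 *\<^sub>R f') (at 0)"
      by (intro tendsto_add tendsto_scaleR_lcs tendsto_const tendsto_ident_at f)
    moreover have "\<forall>\<^sub>F t in at 0. f e + t *\<^sub>R dir_quotient f e u t = f (a t)"
      using ne by eventually_elim (simp add: dir_quotient_def a_def)
    ultimately show ?thesis by (simp add: tendsto_cong)
  qed
  have \<Omega>_lim: "((\<lambda>t. \<Omega> (a t) (x t) (y t)) \<longlongrightarrow> \<Omega> e x' y') (at 0)"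
    if "(x \<longlongrightarrow> x') (at 0)" "(y \<longlongrightarrow> y') (at 0)" for x y x' y'
    using continuous_on_tendsto_compose[OF cont, of "\<lambda>t. (a t, x t, y t)" "(e, x', y')" "at 0"]
      tendsto_Pair[OF a tendsto_Pair[OF that]] a_K K(2) by simp
  have "((\<lambda>t. \<Omega> (a t) (X t) (p\<^sub>2 (a t)) + \<Omega> (a t) (q\<^sub>1 (a t)) (Y t)) \<longlongrightarrow>
      \<Omega> e (p\<^sub>1' - q\<^sub>1') w + \<Omega> e v (p\<^sub>2' - q\<^sub>2')) (at 0)"
    using along[OF p2] along[OF q1] X Y unfolding init by (intro tendsto_add \<Omega>_lim)
  moreover have "\<forall>\<^sub>F t in at 0. \<Omega> (a t) (X t) (p\<^sub>2 (a t)) + \<Omega> (a t) (q\<^sub>1 (a t)) (Y t) = 0"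
    using a_K ne
  proof eventually_elim
    case (elim t)
    have p: "p\<^sub>1 (a t) = 1 *\<^sub>R q\<^sub>1 (a t) + t *\<^sub>R X t" "p\<^sub>2 (a t) = 1 *\<^sub>R q\<^sub>2 (a t) + t *\<^sub>R Y t"
      using elim(2) by (simp_all add: X_def Y_def dir_quotient_def a_def init algebra_simps)
    have "\<Omega> (a t) (p\<^sub>1 (a t)) (p\<^sub>2 (a t)) = \<Omega> (a t) (q\<^sub>1 (a t)) (p\<^sub>2 (a t)) + t * \<Omega> (a t) (X t) (p\<^sub>2 (a t))"
      unfolding p(1) lin1[OF elim(1)] by simp
    also have "\<Omega> (a t) (q\<^sub>1 (a t)) (p\<^sub>2 (a t)) = \<Omega> (a t) (q\<^sub>1 (a t)) (q\<^sub>2 (a t)) + t * \<Omega> (a t) (q\<^sub>1 (a t)) (Y t)"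
      unfolding p(2) lin2[OF elim(1)] by simp
    finally have "t * (\<Omega> (a t) (X t) (p\<^sub>2 (a t)) + \<Omega> (a t) (q\<^sub>1 (a t)) (Y t)) = 0"
      using inv[OF elim(1)] by (simp add: algebra_simps)
    then show ?case using elim(2) by simp
  qed
  then have "((\<lambda>t. \<Omega> (a t) (X t) (p\<^sub>2 (a t)) + \<Omega> (a t) (q\<^sub>1 (a t)) (Y t)) \<longlongrightarrow> 0) (at 0)"
    by (rule tendsto_eventually)
  ultimately show ?thesis by (rule tendsto_unique[rotated]) simp
qed

text \<open>
  The transpositions \<open>(12)\<close> and \<open>(23)\<close> act on \<open>\<omega>([x,y],z)\<close> by \<open>-1\<close> and \<open>+1\<close>. Since
  \<open>(12)(23)(12) = (23)(12)(23)\<close>, the value equals its own negative.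
\<close>

lemma invariant_skew_form_vanishes_on_brackets:
  fixes b :: "'a::ab_group_add \<Rightarrow> 'a \<Rightarrow> 'a" and \<omega> :: "'a \<Rightarrow> 'a \<Rightarrow> real"
  assumes skew: "\<And>x y. \<omega> x y = - \<omega> y x" and b: "\<And>x y. b x y = - b y x"
    and minus: "\<And>x y. \<omega> (- x) y = - \<omega> x y"
    and inv: "\<And>x y z. \<omega> (b x y) z + \<omega> y (b x z) = 0"
  shows "\<omega> (b x y) z = 0"
proof -
  have swap12: "\<omega> (b x y) z = - \<omega> (b y x) z" for x y z
    using b[of x y] minus by simp
  have swap23: "\<omega> (b x y) z = \<omega> (b x z) y" for x y z
    using inv[of x y z] skew[of y "b x z"] by simp
  show ?thesis
    using swap23[of x y z] swap12[of x z y] swap23[of z x y] swap12[of z y x] swap23[of y z x]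
      swap12[of y x z] by linarith
qed

context lie_group_data
begin

definition coord_form ::
    "('g \<Rightarrow> ('g, 'e) tangent_vector \<Rightarrow> ('g, 'e) tangent_vector \<Rightarrow> real) \<Rightarrow> 'e \<Rightarrow> 'e \<Rightarrow> 'e \<Rightarrow> real" where
  "coord_form \<eta> a v w = \<eta> (chart_inv unit_chart a)
     (tangent_of_coord A unit_chart (chart_inv unit_chart a) v)
     (tangent_of_coord A unit_chart (chart_inv unit_chart a) w)"

lemma coord_form_skew:
  assumes "differential_2form A \<eta>" "a \<in> unit_dom"
  shows "coord_form \<eta> a v w = - coord_form \<eta> a w v"
  using assms(1) tangent_of_coord_in_tangent_space[OF atlas unit_chart_point(1)[OF assms(2)]]
  unfolding differential_2form_def coord_form_def by blast

lemma coord_form_linear_left: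
  assumes "differential_2form A \<eta>" "a \<in> unit_dom"
  shows "coord_form \<eta> a (r *\<^sub>R x + s *\<^sub>R y) z = r * coord_form \<eta> a x z + s * coord_form \<eta> a y z"
  using assms(1) tangent_of_coord_in_tangent_space[OF atlas unit_chart_point(1)[OF assms(2)]]
  unfolding differential_2form_def coord_form_def
    tangent_of_coord_lincomb[OF atlas unit_chart_point(1)[OF assms(2)]] by blast

lemma coord_form_linear_right:
  assumes "differential_2form A \<eta>" "a \<in> unit_dom"
  shows "coord_form \<eta> a z (r *\<^sub>R x + s *\<^sub>R y) = r * coord_form \<eta> a z x + s * coord_form \<eta> a z y"
  unfolding coord_form_skew[OF assms, of z] coord_form_linear_left[OF assms] by simp

text \<open>
  This is the continuity clause for derivatives of order \<open>0\<close> in the definition of smoothness.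
\<close>

lemma coord_form_continuous:
  assumes "differential_2form A \<eta>"
  shows "continuous_on (unit_dom \<times> UNIV) (\<lambda>(a, v, w). coord_form \<eta> a v w)"
proof -
  have "smooth_on UNIV (unit_dom \<times> UNIV) (\<lambda>(a, v, w). coord_form \<eta> a v w)"
    using assms unit_chart_atlas unfolding differential_2form_def coord_form_def Let_def by blast
  then have "continuous_on ((unit_dom \<times> UNIV) \<times> (UNIV \<rightarrow> UNIV))
      (\<lambda>(q, v). iter_dir_deriv (unit_dom \<times> UNIV) (\<lambda>(a, v, w). coord_form \<eta> a v w) 0 q v)"
    unfolding smooth_on_def by blast
  then have "continuous_on (unit_dom \<times> UNIV) (\<lambda>q. (\<lambda>(q, v). iter_dir_deriv (unit_dom \<times> UNIV)
      (\<lambda>(a, v, w). coord_form \<eta> a v w) 0 q v) (q, \<lambda>_. 0))"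
    by (rule continuous_on_compose2) (auto intro!: continuous_intros)
  then show ?thesis by simp
qed

lemma coord_form_left_invariant:
  assumes "bi_invariant G \<eta>" and a: "a \<in> unit_dom"
  shows "coord_form \<eta> a (coord_left v a) (coord_left w a) = coord_form \<eta> unit_coord v w"
proof -
  let ?t = "tangent_of_coord A unit_chart (gone G)"
  let ?L = "gmult G (chart_inv unit_chart a)"
  have mem: "?t x \<in> tangent_space A (gone G)" for x
    by (rule tangent_of_coord_in_tangent_space[OF atlas unit_chart_at])
  have "\<eta> (?L (gone G)) (tangent_map A A ?L (gone G) (?t v)) (tangent_map A A ?L (gone G) (?t w)) =
      \<eta> (gone G) (?t v) (?t w)"
    using assms(1) mem unfolding bi_invariant_def Let_def by blast
  then show ?thesis
    unfolding tangent_map_left[OF a] tangent_of_coord_self[OF atlas unit_chart_at]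
    by (simp add: coord_form_def unit_chart_inv)
qed

lemma coord_form_right_invariant:
  assumes "bi_invariant G \<eta>" and a: "a \<in> unit_dom"
  shows "coord_form \<eta> a (coord_right v a) (coord_right w a) = coord_form \<eta> unit_coord v w"
proof -
  let ?t = "tangent_of_coord A unit_chart (gone G)"
  let ?R = "\<lambda>x. gmult G x (chart_inv unit_chart a)"
  have mem: "?t x \<in> tangent_space A (gone G)" for x
    by (rule tangent_of_coord_in_tangent_space[OF atlas unit_chart_at])
  have "\<eta> (?R (gone G)) (tangent_map A A ?R (gone G) (?t v)) (tangent_map A A ?R (gone G) (?t w)) =
      \<eta> (gone G) (?t v) (?t w)"
    using assms(1) mem unfolding bi_invariant_def Let_def by blast
  then show ?thesis
    unfolding tangent_map_right[OF a] tangent_of_coord_self[OF atlas unit_chart_at]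
    by (simp add: coord_form_def unit_chart_inv)
qed

lemma coord_form_vanishes_on_brackets:
  assumes \<eta>: "differential_2form A \<eta>" and inv: "bi_invariant G \<eta>"
  shows "coord_form \<eta> unit_coord (mixed_deriv u v - mixed_deriv v u) w = 0"
proof -
  note lin = coord_form_linear_left[OF \<eta>] coord_form_linear_right[OF \<eta>]
  have bracket_skew: "coord_form \<eta> unit_coord (mixed_deriv u v - mixed_deriv v u) w +
      coord_form \<eta> unit_coord v (mixed_deriv u w - mixed_deriv w u) = 0" for u v w
  proof (rule bilinear_invariance_derivative[OF unit_dom_open unit_coord_mem coord_form_continuous[OF \<eta>] lin])
    show "coord_form \<eta> a (coord_left v a) (coord_left w a) = coord_form \<eta> a (coord_right v a) (coord_right w a)"
      if "a \<in> unit_dom" for a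
      using coord_form_left_invariant[OF inv that] coord_form_right_invariant[OF inv that] by simp
  qed (rule coord_left_unit coord_right_unit coord_left_deriv coord_right_deriv | assumption)+
  show ?thesis
  proof (rule invariant_skew_form_vanishes_on_brackets[where b = "\<lambda>u v. mixed_deriv u v - mixed_deriv v u"])
    show "coord_form \<eta> unit_coord (- x) y = - coord_form \<eta> unit_coord x y" for x y
      using lin(1)[OF unit_coord_mem, of "- 1" x 0 x y] by simp
  qed (rule coord_form_skew[OF \<eta> unit_coord_mem] bracket_skew | simp)+
qed

text \<open>
  The condition is tested on the coordinate in the unit chart, which is defined for all families of
  coordinates, not only for tangent vectors. This makes the vanishing set a closed subspace
  of the ambient product space that contains the brackets, whether or not these are known to be tangent.
\<close>

lemma coord_form_vanishes:
  assumes \<eta>: "differential_2form A \<eta>" and inv: "bi_invariant G \<eta>"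
    and perfect: "topologically_perfect G" and z: "z \<in> lie_algebra G"
  shows "coord_form \<eta> unit_coord (z unit_chart) y = 0"
proof -
  let ?N = "{z. coord_form \<eta> unit_coord (z unit_chart) y = 0}"
  let ?S = "{lie_bracket G v w | v w. v \<in> lie_algebra G \<and> w \<in> lie_algebra G}"
  have "continuous_on UNIV (\<lambda>z::('g, 'e) tangent_vector. (\<lambda>(a, v, w). coord_form \<eta> a v w) (unit_coord, z unit_chart, y))"
    by (rule continuous_on_compose2[OF coord_form_continuous[OF \<eta>]])
      (use unit_coord_mem in \<open>auto intro!: continuous_intros\<close>)
  then have "closed ?N" by (simp add: closed_Collect_eq)
  moreover have "span ?S \<subseteq> ?N"
  proof (rule span_minimal)
    show "?S \<subseteq> ?N" using coord_form_vanishes_on_brackets[OF \<eta> inv] by (auto simp: lie_bracket_coord)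
    have lin: "coord_form \<eta> unit_coord (r *\<^sub>R u + s *\<^sub>R v) y = r * coord_form \<eta> unit_coord u y + s * coord_form \<eta> unit_coord v y"
      for r s u v by (rule coord_form_linear_left[OF \<eta> unit_coord_mem])
    show "subspace ?N"
      using lin[of 0 0 0 0] lin[of 1 _ 1] lin[of _ _ 0]
      by (auto simp: subspace_def scaleR_fun_def)
  qed
  ultimately have "closure (lie_algebra G \<inter> span ?S) \<subseteq> ?N"
    by (intro closure_minimal) auto
  moreover have "z \<in> closure (lie_algebra G \<inter> span ?S)"
    using z perfect by (auto simp: topologically_perfect_def closure_of_subtopology)
  ultimately show ?thesis by auto
qed

lemma bi_invariant_2form_zero:
  assumes \<eta>: "differential_2form A \<eta>" and inv: "bi_invariant G \<eta>"
    and perfect: "topologically_perfect G"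
    and v: "v \<in> tangent_space A p" and w: "w \<in> tangent_space A p"
  shows "\<eta> p v w = 0"
proof -
  let ?L = "gmult G (ginv G p)"
  have L: "?L p = gone G" by (rule left_inverse)
  have "\<eta> p v w = \<eta> (?L p) (tangent_map A A ?L p v) (tangent_map A A ?L p w)"
    using inv v w unfolding bi_invariant_def Let_def by metis
  moreover have "\<eta> (gone G) x y = 0" if "x \<in> tangent_space A (gone G)" "y \<in> tangent_space A (gone G)" for x y
    using coord_form_vanishes[OF \<eta> inv perfect, of x "y unit_chart"] that
      tangent_of_coord_of_tangent[OF _ unit_chart_at]
    by (simp add: coord_form_def unit_chart_inv lie_algebra_def)
  ultimately show ?thesis
    using tangent_map_in_tangent_space[OF atlas atlas C1_map_left, of "ginv G p" p] unfolding L by simp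
qed

end

theorem corollary3p4:
  fixes G :: "('g::t2_space, 'e::locally_convex_space) lie_data"
  assumes "lie_group G"
    and "connected (UNIV :: 'g set)"
    and "milnor_regular G"
    and "topologically_perfect G"
  shows "\<not> (\<exists>\<eta>. differential_2form (gatlas G) \<eta> \<and> bi_invariant G \<eta> \<and>
           (\<exists>p. \<exists>v\<in>tangent_space (gatlas G) p. \<exists>w\<in>tangent_space (gatlas G) p. \<eta> p v w \<noteq> 0))"
proof -
  interpret lie_group_data G by standard (rule assms(1))
  show ?thesis using bi_invariant_2form_zero assms(4) by blast
qed

end
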